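(* Let $d\geq 2$ and $k\in\{1,\ldots,d-1\}$. A finite simple graph $G=(V,E)$ is $(d,k)$-rigid if and only if either $G$ is a complete graph, or $G$ contains a spanning subgraph that is $(d-k)$-rigid and $|E|\geq (d-k)|V|-\binom{d-k+1}{2}+k$.
   Context: A framework $(G,p)$ with $p:V\to\mathbb{R}^d$ is generic if the coordinates of the points $p(v)$, $v\in V$, are distinct and algebraically independent over $\mathbb{Q}$. $p_i$ denotes the $i$-th coordinate of $p$. Fix $v_0\in V$. The matrix $J_{v_0}(G,p)$ (defined when $p_i(v_0)\neq0$ for $i\in\{d-k+1,\ldots,d\}$) has rows indexed by edges $vw\in E$ and by pairs $(v,i)$, $v\in V\setminus\{v_0\}$, $i\in\{d-k+1,\ldots,d\}$, and columns indexed by pairs $(u,j)$, $u\in V$, $j\in\{1,\ldots,d\}$; the edge row $vw$ has $p_j(v)-p_j(w)$ in column $(v,j)$ and $p_j(w)-p_j(v)$ in column $(w,j)$ for all $j$, zeros elsewhere; row $(v,i)$ has $1/p_i(v_0)$ in column $(v,i)$, $-p_i(v)/p_i(v_0)^2$ in column $(v_0,i)$, zeros elsewhere. $(G,p)$ is infinitesimally $(d,k)$-rigid if either $G$ is complete and $\{p(v)\}$ has affine dimension $\min\{d,|V|-1\}$, or $G$ is not complete and $\operatorname{rank}J_{v_0}(G,p)=d|V|-\binom{d-k+1}{2}$. A graph $G$ is $(d,k)$-rigid if some realisation $p:V\to\mathbb{R}^d$ makes $(G,p)$ infinitesimally $(d,k)$-rigid (equivalently, every generic $(G,p)$ in $\mathbb{R}^d$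 is). A graph is $m$-rigid if a (equivalently every) generic framework of it in $\mathbb{R}^m$ is rigid in the usual bar-joint sense (every equivalent framework in a neighbourhood is obtained by an isometry of $\mathbb{R}^m$).
   Formalization: Proved under the added assumption that G is complete or |V| ≥ d−k−1; without it the claim fails, e.g. d=6, k=1, three vertices and one edge: rank J = 3 = 6·3 − C(6,2), yet G is neither complete nor has a 5-rigid spanning subgraph. *)

theory Defs
  imports "HOL-Analysis.Analysis"
begin

text \<open>
  A finite simple graph has the finite type \<^typ>\<open>'v\<close> as its vertex set and is given by its
  set of edges, which are two-element subsets of \<^typ>\<open>'v\<close>.
\<close>

definition simple_graph :: "'v::finite set set \<Rightarrow> bool" where
  "simple_graph E \<longleftrightarrow> (\<forall>e\<in>E. card e = 2)"

definition complete_graph :: "'v::finite set set \<Rightarrow> bool" where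
  "complete_graph E \<longleftrightarrow> E = {e. card e = 2}"

text \<open>
  Algebraic independence over the rationals of a finite family of reals. A polynomial in the
  indeterminates indexed by \<^typ>\<open>'i\<close> is its finitely supported coefficient function on exponent
  vectors. Since this is independence of the family rather than of its range, the members of an
  independent family are distinct.
\<close>

definition alg_indep_over_rat :: "('i::finite \<Rightarrow> real) \<Rightarrow> bool" where
  "alg_indep_over_rat x \<longleftrightarrow>
     (\<forall>c :: ('i \<Rightarrow> nat) \<Rightarrow> rat.
        finite {a. c a \<noteq> 0} \<longrightarrow>
        (\<Sum>a | c a \<noteq> 0. of_rat (c a) * (\<Prod>i\<in>UNIV. x i ^ a i)) = 0 \<longrightarrow>
        (\<forall>a. c a = 0))"

definition generic :: "('v::finite \<Rightarrow> real ^ 'n::finite) \<Rightarrow> bool" where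
  "generic p \<longleftrightarrow> alg_indep_over_rat (\<lambda>(v, i). p v $ i)"

definition equivalent_frameworks ::
  "'v::finite set set \<Rightarrow> ('v \<Rightarrow> real ^ 'n::finite) \<Rightarrow> ('v \<Rightarrow> real ^ 'n) \<Rightarrow> bool" where
  "equivalent_frameworks E p q \<longleftrightarrow>
     (\<forall>v w. {v, w} \<in> E \<longrightarrow> dist (p v) (p w) = dist (q v) (q w))"

definition rigid_framework :: "'v::finite set set \<Rightarrow> ('v \<Rightarrow> real ^ 'n::finite) \<Rightarrow> bool" where
  "rigid_framework E p \<longleftrightarrow>
     (\<exists>\<epsilon>>0. \<forall>q. (\<forall>v. dist (p v) (q v) < \<epsilon>) \<and> equivalent_frameworks E p q \<longrightarrow>
        (\<exists>T. (\<forall>x y. dist (T x) (T y) = dist x y) \<and> (\<forall>v. q v = T (p v))))"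

definition graph_rigid :: "'n::finite itself \<Rightarrow> 'v::finite set set \<Rightarrow> bool" where
  "graph_rigid (_ :: 'n itself) E \<longleftrightarrow>
     (\<exists>p :: 'v \<Rightarrow> real ^ 'n. generic p \<and> rigid_framework E p)"

text \<open>
  The coordinates of \<open>\<real>\<^sup>d\<close> are indexed by \<^typ>\<open>'m + 'k\<close>, where \<^typ>\<open>'m\<close> has \<open>d - k\<close> elements and
  \<^typ>\<open>'k\<close> has \<open>k\<close> elements: the left summand stands for the coordinates \<open>1, \<dots>, d - k\<close> and the
  right summand for \<open>d - k + 1, \<dots>, d\<close>.

  \<open>J_row v0 p r\<close> is the row with index \<open>r\<close> of the matrix \<open>J\<close>. For an edge \<open>e = {u, w}\<close> the sum over
  \<open>e\<close> has only one possibly nonzero term, namely \<open>p u $ j - p w $ j\<close>.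
\<close>

definition J_row ::
  "'v::finite \<Rightarrow> ('v \<Rightarrow> real ^ ('m::finite + 'k::finite)) \<Rightarrow> 'v set + 'v \<times> 'k \<Rightarrow>
     real ^ ('v \<times> ('m + 'k))" where
  "J_row v0 p r =
     (case r of
        Inl e \<Rightarrow> (\<chi> c. case c of (u, j) \<Rightarrow> if u \<in> e then \<Sum>w\<in>e. p u $ j - p w $ j else 0)
      | Inr (v, i) \<Rightarrow> (\<chi> c.
          if c = (v, Inr i) then 1 / p v0 $ Inr i
          else if c = (v0, Inr i) then - (p v $ Inr i) / (p v0 $ Inr i)\<^sup>2
          else 0))"

lemma J_row_edge:
  assumes "v \<noteq> w"
  shows "J_row v0 p (Inl {v, w}) $ (u, j) =
    (if u = v then p v $ j - p w $ j else if u = w then p w $ j - p v $ j else 0)"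
  using assms by (auto simp: J_row_def)

definition J_row_indices :: "'v::finite \<Rightarrow> 'v set set \<Rightarrow> ('v set + 'v \<times> 'k::finite) set" where
  "J_row_indices v0 E = E <+> (UNIV - {v0}) \<times> UNIV"

definition J_rank ::
  "'v::finite \<Rightarrow> 'v set set \<Rightarrow> ('v \<Rightarrow> real ^ ('m::finite + 'k::finite)) \<Rightarrow> nat" where
  "J_rank v0 E p = dim (J_row v0 p ` J_row_indices v0 E)"

definition inf_dk_rigid ::
  "'v::finite \<Rightarrow> 'v set set \<Rightarrow> ('v \<Rightarrow> real ^ ('m::finite + 'k::finite)) \<Rightarrow> bool" where
  "inf_dk_rigid v0 E p \<longleftrightarrow>
     (if complete_graph E
      then aff_dim (range p) = int (min CARD('m + 'k) (CARD('v) - 1))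
      else (\<forall>i :: 'k. p v0 $ Inr i \<noteq> 0) \<and>
           int (J_rank v0 E p) =
             int CARD('m + 'k) * int CARD('v) - int ((CARD('m) + 1) choose 2))"

definition dk_rigid ::
  "'m::finite itself \<Rightarrow> 'k::finite itself \<Rightarrow> 'v::finite \<Rightarrow> 'v set set \<Rightarrow> bool" where
  "dk_rigid (_ :: 'm itself) (_ :: 'k itself) v0 E \<longleftrightarrow>
     (\<exists>p :: 'v \<Rightarrow> real ^ ('m + 'k). inf_dk_rigid v0 E p)"

end

theory Submission
  imports Defs "HOL-Computational_Algebra.Polynomial"
begin

text \<open>
  Write \<open>m = d - k\<close> and \<open>n = |V|\<close>. A vector in the kernel of \<open>J\<close> equals \<open>\<lambda>\<^sub>i p\<^sub>i\<close> in
  the coordinate \<open>i\<close> for each of the last \<open>k\<close> coordinates, so \<open>J\<close> has the required rank iff the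
  rigidity matrix in dimension \<open>m\<close>,
  extended by the \<open>k\<close> columns \<open>((p\<^sub>i v - p\<^sub>i w)\<^sup>2)\<close> indexed by the edges \<open>vw\<close>, has rank
  \<open>m n - (m + 1 choose 2) + k\<close>. Removing \<open>k\<close> columns loses rank at most \<open>k\<close>, which gives the forward
  direction. Conversely, the vectors \<open>((f v - f w)\<^sup>2)\<close> span the whole of \<open>\<real>\<^sup>E\<close>, because a weighted
  graph Laplacian vanishes only if all weights do; hence each new column can be chosen to raise the
  rank as long as the rank is less than \<open>|E|\<close>.

  Generic rigidity is compared with the rank of the rigidity matrix as by Asimow and Roth: a generic
  configuration maximises the rank of every set of rows, so that the constant rank theorem describes
  the fibre of the squared edge lengths near it.
\<close>

section \<open>Independent families and constant rank\<close>

text \<open>Independence is tied to indices rather than to vectors: edges with equal rows count as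
  dependent, and one set of edges can be followed through different configurations.\<close>

definition indep_family :: "'i set \<Rightarrow> ('i \<Rightarrow> 'a::real_vector) \<Rightarrow> bool" where
  "indep_family I r \<longleftrightarrow> (\<forall>c. (\<Sum>i\<in>I. c i *\<^sub>R r i) = 0 \<longrightarrow> (\<forall>i\<in>I. c i = 0))"

lemma indep_family_iff:
  assumes fin: "finite I"
  shows "indep_family I r \<longleftrightarrow> inj_on r I \<and> independent (r ` I)"
proof
  assume ind: "indep_family I r"
  have inj: "inj_on r I"
  proof (rule inj_onI, rule ccontr)
    fix i j assume ij: "i \<in> I" "j \<in> I" "r i = r j" "i \<noteq> j"
    let ?c = "\<lambda>x. if x = i then 1 else if x = j then - 1 else (0::real)"
    have "(\<Sum>x\<in>I. ?c x *\<^sub>R r x) = (\<Sum>x\<in>{i, j}. ?c x *\<^sub>R r x)"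
      by (rule sum.mono_neutral_right) (use fin ij in auto)
    also have "\<dots> = 0"
      using ij by auto
    finally have "?c i = 0"
      using spec[OF ind[unfolded indep_family_def], of ?c] ij(1) by blast
    then show False by simp
  qed
  moreover have "independent (r ` I)"
  proof (rule independent_if_scalars_zero)
    fix f x assume "(\<Sum>x\<in>r ` I. f x *\<^sub>R x) = 0" and x: "x \<in> r ` I"
    then have "(\<Sum>i\<in>I. f (r i) *\<^sub>R r i) = 0"
      by (simp add: sum.reindex[OF inj])
    then show "f x = 0"
      using ind x unfolding indep_family_def by (auto dest: spec[of _ "\<lambda>i. f (r i)"])
  qed (use fin in simp)
  ultimately show "inj_on r I \<and> independent (r ` I)" ..
next
  assume asm: "inj_on r I \<and> independent (r ` I)"
  show "indep_family I r"
    unfolding indep_family_def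
  proof (intro allI impI ballI)
    fix c i assume 0: "(\<Sum>i\<in>I. c i *\<^sub>R r i) = 0" and i: "i \<in> I"
    let ?u = "\<lambda>y. c (inv_into I r y)"
    have "(\<Sum>y\<in>r ` I. ?u y *\<^sub>R y) = (\<Sum>i\<in>I. c i *\<^sub>R r i)"
      using asm by (subst sum.reindex) (auto intro!: sum.cong)
    then have "?u (r i) = 0"
      using asm 0 i fin by (intro independentD[of "r ` I" "r ` I"]) auto
    then show "c i = 0"
      using asm i by simp
  qed
qed

lemma indep_family_insert:
  assumes "finite J" "indep_family J r" "r e \<notin> span (r ` J)"
  shows "indep_family (insert e J) r"
proof -
  have J: "inj_on r J" "independent (r ` J)"
    using assms(1,2) by (simp_all add: indep_family_iff)
  have e: "r e \<notin> r ` J"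
    using assms(3) by (rule contra_subsetD[OF span_superset])
  have "independent (insert (r e) (r ` J))"
    using J(2) assms(3) by (rule independent_insertI[rotated])
  moreover have "inj_on r (insert e J)"
    using J(1) e by (auto simp: inj_on_insert)
  ultimately show ?thesis
    using assms(1) by (simp add: indep_family_iff)
qed

lemma indep_family_spanning_subset:
  fixes r :: "'i \<Rightarrow> 'a::euclidean_space"
  assumes "finite I"
  obtains J where "J \<subseteq> I" "indep_family J r" "r ` I \<subseteq> span (r ` J)" "card J = dim (r ` I)"
proof -
  obtain B where B: "B \<subseteq> r ` I" "independent B" "r ` I \<subseteq> span B" "card B = dim (r ` I)"
    using basis_exists[of "r ` I"] by auto
  obtain J where J: "J \<subseteq> I" "inj_on r J" "B = r ` J"
    using B(1) by (auto simp: subset_image_inj)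
  have "finite J" using J(1) assms finite_subset by blast
  then show thesis
    using that[of J] B J by (simp add: indep_family_iff card_image)
qed

lemma dim_indep_family:
  fixes r :: "'i \<Rightarrow> 'a::euclidean_space"
  assumes "finite J" "indep_family J r"
  shows "dim (r ` J) = card J"
  using assms by (simp add: indep_family_iff dim_eq_card_independent card_image)

text \<open>
  The map \<open>q \<mapsto> (\<Sum>e\<in>J. f e q *\<^sub>R R e p) + P q\<close>, where \<open>P\<close> maps
  into the orthogonal complement \<open>N\<close> of the gradients \<open>R e p\<close> with \<open>e \<in> J\<close>, is a local diffeomorphism that
  turns the level set of \<open>(f e)\<^sub>e\<^sub>\<in>\<^sub>J\<close> into a translate of \<open>N\<close>.
\<close>

lemma constant_rank_level_set:
  fixes f :: "'i \<Rightarrow> 'a::euclidean_space \<Rightarrow> real" and R :: "'i \<Rightarrow> 'a \<Rightarrow> 'a"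
  assumes fin: "finite J" and JK: "J \<subseteq> K" and U: "open U" and pU: "p \<in> U"
    and der: "\<And>e q. e \<in> K \<Longrightarrow> q \<in> U \<Longrightarrow> (f e has_derivative (\<lambda>h. R e q \<bullet> h)) (at q)"
    and cont: "\<And>e. e \<in> K \<Longrightarrow> continuous_on U (R e)"
    and ind: "indep_family J (\<lambda>e. R e p)"
    and sp: "\<And>e q. e \<in> K \<Longrightarrow> q \<in> U \<Longrightarrow> R e q \<in> span ((\<lambda>e. R e q) ` J)"
  obtains W where "open W" "p \<in> W"
    "\<And>q. q \<in> W \<Longrightarrow> (\<forall>e\<in>J. f e q = f e p) \<Longrightarrow> (\<forall>e\<in>K. f e q = f e p)"
    "\<And>u. (\<forall>e\<in>J. R e p \<bullet> u = 0) \<Longrightarrow>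
       \<exists>\<gamma>. \<gamma> 0 = p \<and> (\<gamma> has_vector_derivative u) (at 0) \<and>
         (\<forall>\<^sub>F t in at 0. \<forall>e\<in>K. f e (\<gamma> t) = f e p)"
proof -
  define N where "N = {y. \<forall>e\<in>J. R e p \<bullet> y = 0}"
  have N: "subspace N"
    unfolding N_def subspace_def by (auto simp: inner_add_right)
  obtain B where B: "B \<subseteq> N" "independent B" "span B = N"
    using orthogonal_basis_subspace[OF N] by metis
  have finB: "finite B" using B(2) by (rule independent_imp_finite)
  \<comment> \<open>\<open>B\<close> is not normalised, so \<open>P\<close> need not be the
    orthogonal projection; it suffices that it is linear, maps into \<open>N\<close> and is positive
    definite on \<open>N\<close>.\<close>
  define P where "P y = (\<Sum>b\<in>B. (b \<bullet> y) *\<^sub>R b)" for y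
  have PN: "P y \<in> N" for y
    unfolding P_def using N B(1) by (intro subspace_sum) (auto intro: subspace_scale)
  define h where "h q = (\<Sum>e\<in>J. f e q *\<^sub>R R e p) + P q" for q
  \<comment> \<open>The derivative of \<open>h\<close>, as a \<open>blinfun\<close> because the
    inverse function theorem asks for its continuity in operator norm.\<close>
  define A where "A q = (\<Sum>e\<in>J. blinfun_scaleR_left (R e p) o\<^sub>L blinfun_inner_right (R e q))
     + (\<Sum>b\<in>B. blinfun_scaleR_left b o\<^sub>L blinfun_inner_right b)" for q
  have A: "blinfun_apply (A q) y = (\<Sum>e\<in>J. (R e q \<bullet> y) *\<^sub>R R e p) + P y" for q y
    unfolding A_def P_def by (simp add: plus_blinfun.rep_eq blinfun.sum_left)
  have derh: "(h has_derivative blinfun_apply (A q)) (at q)" if "q \<in> U" for q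
  proof -
    have "(h has_derivative (\<lambda>y. (\<Sum>e\<in>J. (R e q \<bullet> y) *\<^sub>R R e p) + P y)) (at q)"
      unfolding h_def P_def using JK that
      by (auto intro!: derivative_eq_intros der)
    then show ?thesis by (simp add: A[abs_def])
  qed
  have contA: "continuous_on U A"
    unfolding A_def using JK cont
    by (auto intro!: continuous_intros)
  \<comment> \<open>Pairing \<open>A p y\<close> with \<open>y\<close> gives a sum of squares. Its
    vanishing puts \<open>y\<close> into \<open>N\<close> and at the same time makes it orthogonal
    to the basis \<open>B\<close> of \<open>N\<close>.\<close>
  have injA: "y = 0" if "blinfun_apply (A p) y = 0" for y
  proof -
    have "(\<Sum>e\<in>J. (R e p \<bullet> y)\<^sup>2) + (\<Sum>b\<in>B. (b \<bullet> y)\<^sup>2) = blinfun_apply (A p) y \<bullet> y"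
      by (simp add: A P_def inner_add_left inner_sum_left power2_eq_square)
    then have "(\<Sum>e\<in>J. (R e p \<bullet> y)\<^sup>2) + (\<Sum>b\<in>B. (b \<bullet> y)\<^sup>2) = 0"
      using that by simp
    then have "(\<Sum>e\<in>J. (R e p \<bullet> y)\<^sup>2) = 0 \<and> (\<Sum>b\<in>B. (b \<bullet> y)\<^sup>2) = 0"
      by (smt (verit) sum_nonneg zero_le_power2)
    then have "\<forall>e\<in>J. R e p \<bullet> y = 0" and b: "\<forall>b\<in>B. b \<bullet> y = 0"
      using fin finB by (auto simp: sum_nonneg_eq_0_iff)
    then have "y \<in> span B" by (simp add: B N_def)
    then have "orthogonal y y"
      by (rule orthogonal_to_span) (use b in \<open>auto simp: orthogonal_def inner_commute\<close>)
    then show ?thesis by (simp add: orthogonal_def)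
  qed
  have "inj (blinfun_apply (A p))"
    using injA by (simp add: linear_injective_0 bounded_linear.linear[OF blinfun.bounded_linear_right])
  then obtain iA where iA: "linear iA" "iA \<circ> blinfun_apply (A p) = id"
    using linear_injective_left_inverse bounded_linear.linear[OF blinfun.bounded_linear_right] by blast
  have "Blinfun iA o\<^sub>L A p = id_blinfun"
    using iA by (intro blinfun_eqI)
      (simp add: bounded_linear_Blinfun_apply linear_conv_bounded_linear fun_eq_iff)
  then obtain U' V g g' where U': "open U'" "U' \<subseteq> U" "p \<in> U'" and V: "open V" "h p \<in> V"
    and hom: "homeomorphism U' V h g"
    and derg: "\<And>y. y \<in> V \<Longrightarrow> (g has_derivative (g' y)) (at y)"
    and g': "\<And>y. y \<in> V \<Longrightarrow> g' y = inv (blinfun_apply (A (g y)))"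
    and bij: "\<And>y. y \<in> V \<Longrightarrow> bij (blinfun_apply (A (g y)))"
    using inverse_function_theorem[OF U derh contA pU] by blast
  have gp: "g (h p) = p" using hom U' by (simp add: homeomorphism_apply1)
  obtain \<epsilon> where eps: "\<epsilon> > 0" "ball (h p) \<epsilon> \<subseteq> V"
    using V openE by blast
  \<comment> \<open>The span of the gradients meets its orthogonal complement \<open>N\<close> only
    in 0, so working modulo \<open>N\<close> loses nothing of the \<open>J\<close>-part of
    \<open>h\<close>.\<close>
  have split: "\<forall>e\<in>J. a e = 0" if "(\<Sum>e\<in>J. a e *\<^sub>R R e p) \<in> N" for a
  proof -
    let ?x = "\<Sum>e\<in>J. a e *\<^sub>R R e p"
    have "?x \<bullet> ?x = (\<Sum>e\<in>J. a e * (R e p \<bullet> ?x))"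
      by (subst inner_sum_left) simp
    also have "\<dots> = 0"
      using that by (simp add: N_def)
    finally have "?x = 0" by simp
    then show ?thesis using ind unfolding indep_family_def by blast
  qed
  \<comment> \<open>On the slice through \<open>h p\<close> in a direction of \<open>N\<close> the
    functions indexed by \<open>J\<close> are constant by \<open>split\<close>. The gradients of the
    others lie in the span of those of \<open>J\<close>, so their derivatives along the curve vanish
    as well.\<close>
  have curve: "f e (g (h p + t *\<^sub>R s)) = f e p"
    if s: "s \<in> N" and t: "h p + t *\<^sub>R s \<in> ball (h p) \<epsilon>" and e: "e \<in> K" for s t e
  proof -
    let ?T = "(\<lambda>t. h p + t *\<^sub>R s) -` ball (h p) \<epsilon>"
    let ?\<gamma> = "\<lambda>t. g (h p + t *\<^sub>R s)"
    have openT: "open ?T"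
      by (intro open_vimage) (auto intro!: continuous_intros)
    \<comment> \<open>The parameters form an interval, on which a zero derivative forces
      constancy.\<close>
    have convT: "convex ?T"
    proof (rule convexI)
      fix x y u v :: real
      assume xy: "x \<in> ?T" "y \<in> ?T" and uv: "0 \<le> u" "0 \<le> v" "u + v = 1"
      have "u *\<^sub>R (h p + x *\<^sub>R s) + v *\<^sub>R (h p + y *\<^sub>R s) \<in> ball (h p) \<epsilon>"
        using xy uv by (intro convexD[OF convex_ball]) auto
      moreover have "u *\<^sub>R (h p + x *\<^sub>R s) + v *\<^sub>R (h p + y *\<^sub>R s)
          = (u + v) *\<^sub>R h p + (u *\<^sub>R x + v *\<^sub>R y) *\<^sub>R s"
        by (simp add: algebra_simps)
      ultimately show "u *\<^sub>R x + v *\<^sub>R y \<in> ?T"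
        using uv(3) by simp
    qed
    have inU: "?\<gamma> t \<in> U'" and hg: "h (?\<gamma> t) = h p + t *\<^sub>R s" if "t \<in> ?T" for t
      using that eps(2) hom by (auto simp: homeomorphism_def)
    have J: "f e (?\<gamma> t) = f e p" if "t \<in> ?T" "e \<in> J" for t e
    proof -
      have "(\<Sum>e\<in>J. (f e (?\<gamma> t) - f e p) *\<^sub>R R e p) = t *\<^sub>R s - P (?\<gamma> t) + P p"
        using hg[OF that(1)] unfolding h_def
        by (simp add: scaleR_left_diff_distrib sum_subtractf algebra_simps)
      also have "\<dots> \<in> N"
        using s PN N by (intro subspace_add subspace_diff subspace_scale) auto
      finally show ?thesis using split that(2) by fastforce
    qed
    have d: "((\<lambda>t. f e (?\<gamma> t)) has_derivative (\<lambda>x. x * (R e (?\<gamma> t) \<bullet> g' (h p + t *\<^sub>R s) s))) (at t)"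
      if "t \<in> ?T" "e \<in> K" for t e
    proof -
      have y: "h p + t *\<^sub>R s \<in> V" using that eps(2) by auto
      have "((\<lambda>t. h p + t *\<^sub>R s) has_derivative (\<lambda>x. x *\<^sub>R s)) (at t)"
        by (auto intro!: derivative_eq_intros)
      from has_derivative_compose[OF this derg[OF y]]
      have "(?\<gamma> has_derivative (\<lambda>x. g' (h p + t *\<^sub>R s) (x *\<^sub>R s))) (at t)" .
      from has_derivative_compose[OF this der[OF that(2)]] inU[OF that(1)] U'(2)
      have "((\<lambda>t. f e (?\<gamma> t)) has_derivative (\<lambda>x. R e (?\<gamma> t) \<bullet> g' (h p + t *\<^sub>R s) (x *\<^sub>R s))) (at t)"
        by blast
      then show ?thesis
        using has_derivative_linear[OF derg[OF y]] by (simp add: linear_cmul)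
    qed
    have dJ: "R e (?\<gamma> t) \<bullet> g' (h p + t *\<^sub>R s) s = 0" if "t \<in> ?T" "e \<in> J" for t e
    proof -
      have "((\<lambda>t. f e (?\<gamma> t)) has_derivative (\<lambda>x. 0)) (at t)"
        by (rule has_derivative_transform_within_open[OF _ openT that(1)])
          (auto simp: J[OF _ that(2)] intro!: derivative_eq_intros)
      from has_derivative_unique[OF this d[OF that(1)]] that(2) JK
      have "(\<lambda>x. 0) = (\<lambda>x. x * (R e (?\<gamma> t) \<bullet> g' (h p + t *\<^sub>R s) s))" by blast
      from fun_cong[OF this, of 1] show ?thesis by simp
    qed
    have "((\<lambda>t. f e (?\<gamma> t)) has_derivative (\<lambda>x. 0)) (at t within ?T)" if "t \<in> ?T" for t
    proof -
      have "orthogonal (g' (h p + t *\<^sub>R s) s) (R e (?\<gamma> t))"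
      proof (rule orthogonal_to_span)
        show "R e (?\<gamma> t) \<in> span ((\<lambda>e. R e (?\<gamma> t)) ` J)"
          using sp[OF e] inU[OF that] U'(2) by blast
      qed (use dJ[OF that] in \<open>auto simp: orthogonal_def inner_commute\<close>)
      then have "R e (?\<gamma> t) \<bullet> g' (h p + t *\<^sub>R s) s = 0"
        by (simp add: orthogonal_def inner_commute)
      then show ?thesis
        using has_derivative_at_withinI[OF d[OF that e]] by simp
    qed
    from has_derivative_zero_unique[OF convT this, of t 0]
    show ?thesis using t eps(1) gp by simp
  qed
  define W where "W = U' \<inter> h -` ball (h p) \<epsilon>"
  have "continuous_on U' h" using hom by (simp add: homeomorphism_def)
  then have "open W"
    unfolding W_def using U'(1) by (intro continuous_open_preimage) auto
  moreover have "p \<in> W" using U' eps by (simp add: W_def)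
  \<comment> \<open>Equal values on \<open>J\<close> put \<open>h q\<close> on the slice through
    \<open>h p\<close>; \<open>q\<close> is then the point of the curve with parameter 1.\<close>
  moreover have "\<forall>e\<in>K. f e q = f e p" if q: "q \<in> W" "\<forall>e\<in>J. f e q = f e p" for q
  proof
    fix e assume e: "e \<in> K"
    have "h q - h p = P q - P p" using q(2) by (simp add: h_def)
    then have "h q - h p \<in> N" using PN N by (simp add: subspace_diff)
    from curve[OF this _ e, of 1] q(1) show "f e q = f e p"
      using hom by (simp add: W_def homeomorphism_def)
  qed
  moreover have "\<exists>\<gamma>. \<gamma> 0 = p \<and> (\<gamma> has_vector_derivative u) (at 0) \<and>
         (\<forall>\<^sub>F t in at 0. \<forall>e\<in>K. f e (\<gamma> t) = f e p)" if u: "\<forall>e\<in>J. R e p \<bullet> u = 0" for u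
  proof -
    \<comment> \<open>For \<open>u\<close> orthogonal to the gradients the first sum in
      \<open>A p u\<close> vanishes, so \<open>A p\<close> sends \<open>u\<close> to
      \<open>s\<close> and the lifted line has velocity \<open>u\<close> at 0.\<close>
    define s where "s = P u"
    have s: "s = blinfun_apply (A p) u" using u by (simp add: A s_def)
    have "g' (h p) s = u"
      using g'[OF V(2)] bij[OF V(2)] by (simp add: gp s bij_is_inj)
    define \<gamma> where "\<gamma> t = g (h p + t *\<^sub>R s)" for t
    have "((\<lambda>t. h p + t *\<^sub>R s) has_derivative (\<lambda>x. x *\<^sub>R s)) (at 0)"
      by (auto intro!: derivative_eq_intros)
    from has_derivative_compose[OF this, of g "g' (h p)"] derg[OF V(2)]
    have "(\<gamma> has_derivative (\<lambda>x. g' (h p) (x *\<^sub>R s))) (at 0)"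
      by (simp add: \<gamma>_def[abs_def])
    then have "(\<gamma> has_vector_derivative u) (at 0)"
      using \<open>g' (h p) s = u\<close> has_derivative_linear[OF derg[OF V(2)]]
      by (simp add: has_vector_derivative_def linear_cmul)
    moreover have "\<gamma> 0 = p" by (simp add: \<gamma>_def gp)
    moreover have "\<forall>\<^sub>F t in at 0. h p + t *\<^sub>R s \<in> ball (h p) \<epsilon>"
      by (rule topological_tendstoD[where l = "h p"])
        (use eps in \<open>auto intro!: tendsto_eq_intros\<close>)
    then have "\<forall>\<^sub>F t in at 0. \<forall>e\<in>K. f e (\<gamma> t) = f e p"
      by (rule eventually_mono) (use curve[of s] PN in \<open>auto simp: \<gamma>_def s_def\<close>)
    ultimately show ?thesis by blast
  qed
  ultimately show thesis using that by blast
qed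

section \<open>Algebraic independence over the rationals\<close>

definition rat_poly_eval :: "(('i::finite \<Rightarrow> nat) \<Rightarrow> rat) \<Rightarrow> ('i \<Rightarrow> real) \<Rightarrow> real" where
  "rat_poly_eval c x = (\<Sum>a | c a \<noteq> 0. of_rat (c a) * (\<Prod>i\<in>UNIV. x i ^ a i))"

text \<open>Hiding the coefficients lets a determinant be recognised as a polynomial through closure
  under sums and products alone.\<close>

definition rat_poly_fun :: "(('i::finite \<Rightarrow> real) \<Rightarrow> real) \<Rightarrow> bool" where
  "rat_poly_fun f \<longleftrightarrow> (\<exists>c. finite {a. c a \<noteq> 0} \<and> f = rat_poly_eval c)"

lemma rat_poly_eval_superset:
  assumes "finite A" "{a. c a \<noteq> 0} \<subseteq> A"
  shows "rat_poly_eval c x = (\<Sum>a\<in>A. of_rat (c a) * (\<Prod>i\<in>UNIV. x i ^ a i))"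
  unfolding rat_poly_eval_def by (rule sum.mono_neutral_left) (use assms in auto)

lemma rat_poly_fun_add:
  assumes "rat_poly_fun f" "rat_poly_fun g"
  shows "rat_poly_fun (\<lambda>x. f x + g x)"
proof -
  obtain c d where c: "finite {a. c a \<noteq> 0}" "f = rat_poly_eval c"
    and d: "finite {a. d a \<noteq> 0}" "g = rat_poly_eval d"
    using assms unfolding rat_poly_fun_def by auto
  let ?A = "{a. c a \<noteq> 0} \<union> {a. d a \<noteq> 0}"
  have sub: "{a. c a + d a \<noteq> 0} \<subseteq> ?A" by auto
  have fin: "finite ?A" using c d by simp
  have "f x + g x = rat_poly_eval (\<lambda>a. c a + d a) x" for x
    unfolding c d
    by (subst (1 2 3) rat_poly_eval_superset[OF fin]) (auto simp: of_rat_add sum.distrib algebra_simps)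
  moreover have "finite {a. c a + d a \<noteq> 0}"
    using finite_subset[OF sub fin] .
  ultimately show ?thesis
    unfolding rat_poly_fun_def by (intro exI[of _ "\<lambda>a. c a + d a"]) auto
qed

lemma rat_poly_fun_monomial: "rat_poly_fun (\<lambda>x. of_rat r * (\<Prod>i\<in>UNIV. x i ^ a i))"
proof -
  let ?c = "\<lambda>b. if b = a then r else 0"
  have "of_rat r * (\<Prod>i\<in>UNIV. x i ^ a i) = rat_poly_eval ?c x" for x
    by (subst rat_poly_eval_superset[of "{a}"]) auto
  moreover have "finite {b. ?c b \<noteq> 0}"
    by (rule finite_subset[of _ "{a}"]) auto
  ultimately show ?thesis
    unfolding rat_poly_fun_def by (intro exI[of _ ?c]) auto
qed

lemma rat_poly_fun_const: "rat_poly_fun (\<lambda>x. of_rat r)"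
  using rat_poly_fun_monomial[of r "\<lambda>_. 0"] by simp

lemma rat_poly_fun_of_int: "rat_poly_fun (\<lambda>x. of_int z)"
  using rat_poly_fun_const[of "of_int z"] by simp

lemma rat_poly_fun_var: "rat_poly_fun (\<lambda>x. x i)"
proof -
  have "(\<Prod>j\<in>UNIV. x j ^ (if j = i then 1 else 0)) = x i" for x :: "'a \<Rightarrow> real"
    by (subst prod.mono_neutral_right[of _ "{i}"]) auto
  then show ?thesis
    using rat_poly_fun_monomial[of 1 "\<lambda>j. if j = i then 1 else 0"] by simp
qed

lemma rat_poly_fun_sum:
  assumes "\<And>t. t \<in> T \<Longrightarrow> rat_poly_fun (f t)"
  shows "rat_poly_fun (\<lambda>x. \<Sum>t\<in>T. f t x)"
proof (cases "finite T")
  case True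
  then show ?thesis using assms
    by induction (auto intro: rat_poly_fun_add rat_poly_fun_of_int[of 0, simplified])
qed (use rat_poly_fun_of_int[of 0] in simp)

lemma rat_poly_fun_mult:
  assumes "rat_poly_fun f" "rat_poly_fun g"
  shows "rat_poly_fun (\<lambda>x. f x * g x)"
proof -
  obtain c d where c: "f = rat_poly_eval c" and d: "g = rat_poly_eval d"
    using assms unfolding rat_poly_fun_def by auto
  have "f x * g x = (\<Sum>a | c a \<noteq> 0. \<Sum>b | d b \<noteq> 0.
      of_rat (c a * d b) * (\<Prod>i\<in>UNIV. x i ^ (a i + b i)))" for x
    unfolding c d rat_poly_eval_def
    by (simp add: sum_product of_rat_mult power_add prod.distrib mult_ac)
  then show ?thesis
    by (simp only:) (intro rat_poly_fun_sum rat_poly_fun_monomial)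
qed

lemma rat_poly_fun_prod:
  assumes "\<And>t. t \<in> T \<Longrightarrow> rat_poly_fun (f t)"
  shows "rat_poly_fun (\<lambda>x. \<Prod>t\<in>T. f t x)"
proof (cases "finite T")
  case True
  then show ?thesis using assms
    by induction (auto intro: rat_poly_fun_mult rat_poly_fun_of_int[of 1, simplified])
qed (use rat_poly_fun_of_int[of 1] in simp)

lemma rat_poly_fun_diff:
  assumes "rat_poly_fun f" "rat_poly_fun g"
  shows "rat_poly_fun (\<lambda>x. f x - g x)"
  using rat_poly_fun_add[OF assms(1) rat_poly_fun_mult[OF rat_poly_fun_of_int[of "-1"] assms(2)]]
  by simp

lemma rat_poly_fun_det:
  assumes "\<And>i j. rat_poly_fun (\<lambda>x. M x $ i $ j)"
  shows "rat_poly_fun (\<lambda>x. det (M x))"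
  unfolding det_def
  by (intro rat_poly_fun_sum rat_poly_fun_mult rat_poly_fun_prod rat_poly_fun_of_int assms)

text \<open>Independence of \<open>x\<close> forces all coefficients to be 0. Read contrapositively,
  a non-zero value at any single \<open>y\<close> is inherited by every independent point.\<close>

lemma rat_poly_fun_eq_0:
  assumes "alg_indep_over_rat x" "rat_poly_fun f" "f x = 0"
  shows "f y = 0"
proof -
  obtain c where c: "finite {a. c a \<noteq> 0}" "f = rat_poly_eval c"
    using assms(2) unfolding rat_poly_fun_def by auto
  then have "\<forall>a. c a = 0"
    using assms(1,3) unfolding alg_indep_over_rat_def rat_poly_eval_def by blast
  then show ?thesis by (simp add: c rat_poly_eval_def)
qed

section \<open>Existence of algebraically independent reals\<close>

lemma countable_finite_support:
  "countable {c :: ('i::finite \<Rightarrow> nat) \<Rightarrow> rat. finite {a. c a \<noteq> 0}}"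
proof -
  \<comment> \<open>The graph over the support determines the coefficient function and is a finite
    subset of a countable type.\<close>
  let ?g = "\<lambda>c :: ('i \<Rightarrow> nat) \<Rightarrow> rat. (\<lambda>a. (a, c a)) ` {a. c a \<noteq> 0}"
  have inj: "inj ?g"
  proof (rule injI, rule ext)
    fix c d a assume "?g c = ?g d"
    then have *: "(a, y) \<in> ?g c \<longleftrightarrow> (a, y) \<in> ?g d" for y by simp
    from *[of "c a"] *[of "d a"] show "c a = d a" by auto
  qed
  have "countable (?g ` {c. finite {a. c a \<noteq> 0}})"
    by (rule countable_subset[OF _ countable_Collect_finite]) auto
  then show ?thesis
    using countable_image_inj_on inj inj_on_subset by blast
qed

text \<open>Induction on the set \<open>S\<close> of variables that may occur. Over independent old
  coordinates each non-zero polynomial becomes a non-zero univariate polynomial in the new one;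
  there are countably many of these, with finitely many roots each, while the reals are
  uncountable.\<close>

lemma alg_indep_over_rat_on_exists:
  assumes "finite S"
  shows "\<exists>x :: 'i::finite \<Rightarrow> real. \<forall>c. finite {a. c a \<noteq> 0} \<longrightarrow>
    (\<forall>a i. c a \<noteq> 0 \<longrightarrow> i \<notin> S \<longrightarrow> a i = 0) \<longrightarrow> rat_poly_eval c x = 0 \<longrightarrow> (\<forall>a. c a = 0)"
  using assms
proof (induction S)
  case empty
  \<comment> \<open>Without variables only the constant term is left, and it is the value at 0
    because \<open>0 ^ 0 = 1\<close>.\<close>
  have "c a = 0" if "\<forall>a i. c a \<noteq> 0 \<longrightarrow> a i = 0" "rat_poly_eval c (\<lambda>_. 0) = 0"
    for c :: "('i \<Rightarrow> nat) \<Rightarrow> rat" and a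
  proof -
    have *: "c a \<noteq> 0 \<Longrightarrow> a = (\<lambda>_. 0)" for a using that(1) by blast
    then have "rat_poly_eval c (\<lambda>_. 0) = of_rat (c (\<lambda>_. 0))"
      by (subst rat_poly_eval_superset[of "{\<lambda>_. 0}"]) auto
    then show ?thesis using that(2) * by fastforce
  qed
  then show ?case by auto
next
  case (insert i S)
  then obtain x :: "'i \<Rightarrow> real" where x: "\<And>c a. finite {a. c a \<noteq> 0} \<Longrightarrow>
    (\<forall>a i. c a \<noteq> 0 \<longrightarrow> i \<notin> S \<longrightarrow> a i = 0) \<Longrightarrow> rat_poly_eval c x = 0 \<Longrightarrow> c a = 0"
    by auto
  define m where "m a = (\<Prod>l\<in>UNIV - {i}. x l ^ a l)" for a :: "'i \<Rightarrow> nat"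
  \<comment> \<open>The polynomial in the new variable \<open>i\<close>, with the value of
    \<open>x\<close> substituted for all others.\<close>
  define q where "q c = (\<Sum>a | c a \<noteq> 0. monom (of_rat (c a) * m a) (a i))"
    for c :: "('i \<Rightarrow> nat) \<Rightarrow> rat"
  have q: "poly (q c) t = rat_poly_eval c (x(i := t))" for c t
  proof -
    have "(\<Prod>l\<in>UNIV. (x(i := t)) l ^ a l) = t ^ a i * m a" for a
      by (subst prod.remove[of _ i]) (auto simp: m_def intro!: prod.cong)
    then show ?thesis
      unfolding q_def rat_poly_eval_def by (simp add: poly_sum poly_monom mult_ac)
  qed
  define C where "C = {c :: ('i \<Rightarrow> nat) \<Rightarrow> rat. finite {a. c a \<noteq> 0} \<and>
    (\<forall>a l. c a \<noteq> 0 \<longrightarrow> l \<notin> insert i S \<longrightarrow> a l = 0) \<and> (\<exists>a. c a \<noteq> 0)}"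
  have nz: "q c \<noteq> 0" if "c \<in> C" for c
  proof
    assume "q c = 0"
    obtain a0 where a0: "c a0 \<noteq> 0" using \<open>c \<in> C\<close> by (auto simp: C_def)
    let ?A = "{a. c a \<noteq> 0}"
    have fin: "finite ?A" using \<open>c \<in> C\<close> by (simp add: C_def)
    \<comment> \<open>the coefficient of the \<open>i\<close>-th variable to the power \<open>a0 i\<close>, as a polynomial in the others\<close>
    define c' where "c' b = (if b i = 0 then c (b(i := a0 i)) else 0)" for b
    let ?B = "{a\<in>?A. a i = a0 i}"
    have supp: "{b. c' b \<noteq> 0} = (\<lambda>a. a(i := 0)) ` ?B"
    proof safe
      fix b assume "c' b \<noteq> 0"
      then have "b i = 0" "c (b(i := a0 i)) \<noteq> 0" by (auto simp: c'_def split: if_splits)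
      then show "b \<in> (\<lambda>a. a(i := 0)) ` ?B"
        by (intro image_eqI[of _ _ "b(i := a0 i)"]) (auto simp: fun_upd_idem)
    next
      fix a assume "c a \<noteq> 0" "a i = a0 i" "c' (a(i := 0)) = 0"
      then show False by (simp add: c'_def fun_upd_idem)
    qed
    have inj: "inj_on (\<lambda>a. a(i := 0)) ?B"
    proof (rule inj_onI)
      fix a b assume ab: "a \<in> ?B" "b \<in> ?B" and eq: "a(i := 0) = b(i := 0)"
      show "a = b"
      proof
        fix l show "a l = b l" using ab fun_cong[OF eq, of l] by (cases "l = i") auto
      qed
    qed
    have "rat_poly_eval c' x = (\<Sum>a\<in>?B. of_rat (c a) * m a)"
      unfolding rat_poly_eval_def supp sum.reindex[OF inj]
    proof (rule sum.cong)
      fix a assume a: "a \<in> ?B"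
      have "(\<Prod>l\<in>UNIV. x l ^ (a(i := 0)) l) = m a"
        by (subst prod.remove[of _ i]) (auto simp: m_def intro!: prod.cong)
      moreover have "c' (a(i := 0)) = c a"
        using a by (simp add: c'_def fun_upd_idem)
      ultimately show "((\<lambda>a. of_rat (c' a) * (\<Prod>l\<in>UNIV. x l ^ a l)) \<circ> (\<lambda>a. a(i := 0))) a
          = of_rat (c a) * m a"
        by simp
    qed simp
    also have "\<dots> = (\<Sum>a\<in>?A. if a i = a0 i then of_rat (c a) * m a else 0)"
      using fin by (rule sum.inter_filter)
    also have "\<dots> = coeff (q c) (a0 i)"
      unfolding q_def coeff_sum by (rule sum.cong) auto
    finally have "rat_poly_eval c' x = 0"
      using \<open>q c = 0\<close> by simp
    moreover have "finite {b. c' b \<noteq> 0}" using fin by (simp add: supp)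
    moreover have "\<forall>a l. c' a \<noteq> 0 \<longrightarrow> l \<notin> S \<longrightarrow> a l = 0"
    proof (intro allI impI)
      fix b l assume "c' b \<noteq> 0" "l \<notin> S"
      then obtain a where "b = a(i := 0)" "c a \<noteq> 0" using supp by blast
      then show "b l = 0"
        using \<open>c \<in> C\<close> \<open>l \<notin> S\<close> by (auto simp: C_def)
    qed
    ultimately have "c' (a0(i := 0)) = 0" using x by blast
    then show False using a0 by (simp add: c'_def fun_upd_idem)
  qed
  have "countable C"
    by (rule countable_subset[OF _ countable_finite_support]) (auto simp: C_def)
  then have "countable (\<Union>c\<in>C. {t. poly (q c) t = 0})"
    using nz by (auto intro!: countable_UN intro: countable_finite poly_roots_finite)
  then obtain t where t: "t \<notin> (\<Union>c\<in>C. {t. poly (q c) t = 0})"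
    using uncountable_UNIV_real by (metis UNIV_eq_I)
  then have "rat_poly_eval c (x(i := t)) \<noteq> 0" if "c \<in> C" for c
    using that by (simp add: q)
  then show ?case
    unfolding C_def by (intro exI[of _ "x(i := t)"]) blast
qed

lemma alg_indep_over_rat_exists: "\<exists>x :: 'i::finite \<Rightarrow> real. alg_indep_over_rat x"
  using alg_indep_over_rat_on_exists[OF finite_class.finite_UNIV]
  unfolding alg_indep_over_rat_def rat_poly_eval_def by auto

section \<open>Infinitesimal and finite isometries of spanning configurations\<close>

text \<open>\<open>L\<close> is fixed on a basis chosen among the \<open>a i\<close>. Expressing any
  further \<open>a i\<close> in that basis is a linear relation, which \<open>rel\<close> carries
  over to the \<open>b i\<close>.\<close>

lemma linear_map_on_spanning_family:
  fixes a :: "'i::finite \<Rightarrow> 'a::euclidean_space" and b :: "'i \<Rightarrow> 'b::real_vector"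
  assumes span: "span (range a) = UNIV"
    and rel: "\<And>c. (\<Sum>i\<in>UNIV. c i *\<^sub>R a i) = 0 \<Longrightarrow> (\<Sum>i\<in>UNIV. c i *\<^sub>R b i) = 0"
  obtains L where "linear L" "\<And>i. L (a i) = b i"
proof -
  obtain J where J: "indep_family J a" "range a \<subseteq> span (a ` J)"
    using indep_family_spanning_subset[OF finite_class.finite_UNIV] by metis
  have inj: "inj_on a J" and ind: "independent (a ` J)"
    using J(1) by (simp_all add: indep_family_iff)
  obtain L where L: "linear L" "\<forall>x\<in>a ` J. L x = b (inv_into J a x)"
    using linear_independent_extend[OF ind, of "\<lambda>x. b (inv_into J a x)"] by auto
  have "L (a i) = b i" for i
  proof -
    have "a i \<in> span (a ` J)" using J(2) by blast
    then obtain u where "a i = (\<Sum>x\<in>a ` J. u x *\<^sub>R x)"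
      by (auto simp: span_finite)
    then have ai: "a i = (\<Sum>j\<in>J. u (a j) *\<^sub>R a j)"
      by (simp add: sum.reindex[OF inj])
    \<comment> \<open>The coefficients of the relation "basis expansion of \<open>a i\<close> minus
      \<open>a i\<close>", over all indices.\<close>
    define c where "c j = (if j \<in> J then u (a j) else 0) - (if j = i then 1 else 0)" for j
    have sum: "(\<Sum>j\<in>UNIV. c j *\<^sub>R y j) = (\<Sum>j\<in>J. u (a j) *\<^sub>R y j) - y i"
      for y :: "'i \<Rightarrow> 'c::real_vector"
      unfolding c_def
      by (simp add: scaleR_left_diff_distrib sum_subtractf if_distrib[of "\<lambda>s. s *\<^sub>R _"]
          sum.If_cases cong: if_cong)
    have "(\<Sum>j\<in>J. u (a j) *\<^sub>R b j) = b i"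
      using rel[of c] ai by (simp add: sum)
    moreover have "L (a i) = (\<Sum>j\<in>J. u (a j) *\<^sub>R b j)"
      using L inj by (subst ai) (simp add: linear_sum linear_cmul)
    ultimately show ?thesis by simp
  qed
  then show thesis using that L(1) by blast
qed

lemma eq_0_if_orthogonal_spanning:
  assumes "span S = UNIV" "\<And>y. y \<in> S \<Longrightarrow> x \<bullet> y = 0"
  shows "x = (0::'a::real_inner)"
proof -
  have "orthogonal x x"
    by (rule orthogonal_to_span[of _ S]) (auto simp: orthogonal_def assms)
  then show ?thesis by (simp add: orthogonal_def)
qed

section \<open>Dimension of the space of skew matrices\<close>

lemma dim_coordinate_subspace:
  "dim {x :: real ^ 'n::finite. \<forall>i. i \<notin> d \<longrightarrow> x $ i = 0} = card d"
  using dim_substandard_cart[where 'a = real, of d] by (simp add: dim_vec_eq)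

lemma subspace_skew_matrices:
  "subspace {A :: real ^ 'm ^ 'm::finite. \<forall>i j. A $ i $ j + A $ j $ i = 0}"
proof (rule subspaceI)
  fix A B :: "real ^ 'm ^ 'm" and c :: real
  assume A: "A \<in> {A. \<forall>i j. A $ i $ j + A $ j $ i = 0}"
  show "c *\<^sub>R A \<in> {A. \<forall>i j. A $ i $ j + A $ j $ i = 0}"
    using A by (simp add: distrib_left[symmetric])
  assume B: "B \<in> {A. \<forall>i j. A $ i $ j + A $ j $ i = 0}"
  have "(A + B) $ i $ j + (A + B) $ j $ i = (A $ i $ j + A $ j $ i) + (B $ i $ j + B $ j $ i)" for i j
    by simp
  then show "A + B \<in> {A. \<forall>i j. A $ i $ j + A $ j $ i = 0}"
    using A B by (simp del: vector_add_component)
qed simp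

text \<open>The entries above the diagonal can be chosen freely and determine the rest.\<close>

lemma dim_skew_matrices:
  "dim {A :: real ^ 'm ^ 'm::finite. \<forall>i j. A $ i $ j + A $ j $ i = 0} = CARD('m) choose 2"
proof -
  \<comment> \<open>The index type carries no order; \<open>f\<close> pulls one back from the
    naturals to say which entries are above the diagonal.\<close>
  obtain f :: "'m \<Rightarrow> nat" where f: "inj f"
    using finite_imp_inj_to_nat_seg[of "UNIV :: 'm set"] by auto
  define P where "P = {(i, j). f i < f j}"
  have neq: "(j, i) \<in> P \<longleftrightarrow> (i, j) \<notin> P \<and> i \<noteq> j" for i j
    using f by (auto simp: P_def inj_def) (metis linorder_neqE_nat)
  define T where "T = {B :: real ^ ('m \<times> 'm). \<forall>q. q \<notin> P \<longrightarrow> B $ q = 0}"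
  define L :: "real ^ ('m \<times> 'm) \<Rightarrow> real ^ 'm ^ 'm"
    where "L B = (\<chi> i j. B $ (i, j) - B $ (j, i))" for B
  have L: "linear L"
    by (rule linearI) (auto simp: L_def vec_eq_iff algebra_simps)
  have T: "subspace T"
    by (auto simp: T_def subspace_def)
  have "inj_on L T"
  proof (rule inj_onI)
    fix B C assume BC: "B \<in> T" "C \<in> T" "L B = L C"
    have "B $ (i, j) = C $ (i, j)" for i j
    proof (cases "(i, j) \<in> P")
      case True
      then have "(j, i) \<notin> P" using neq by blast
      moreover have "L B $ i $ j = L C $ i $ j" using BC by simp
      ultimately show ?thesis using BC by (simp add: L_def T_def)
    qed (use BC in \<open>auto simp: T_def\<close>)
    then show "B = C" by (simp add: vec_eq_iff)
  qed
  then have "dim (L ` T) = dim T"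
    using T by (intro dim_image_eq[OF L]) (simp add: span_eq_iff[THEN iffD2])
  also have "\<dots> = card P"
    unfolding T_def by (rule dim_coordinate_subspace)
  also have "L ` T = {A. \<forall>i j. A $ i $ j + A $ j $ i = 0}" (is "_ = ?S")
  proof
    show "L ` T \<subseteq> ?S" by (auto simp: L_def)
    show "?S \<subseteq> L ` T"
    proof
      fix A assume A: "A \<in> ?S"
      let ?B = "\<chi> q. if q \<in> P then A $ fst q $ snd q else 0"
      have sk: "A $ i $ j + A $ j $ i = 0" for i j using A by blast
      have "L ?B $ i $ j = A $ i $ j" for i j
      proof (cases "(i, j) \<in> P")
        case True
        then show ?thesis using neq[of i j] by (simp add: L_def)
      next
        case False
        then show ?thesis
          using neq[of i j] sk[of i j] by (cases "i = j") (auto simp: L_def)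
      qed
      then have "L ?B = A" by (simp add: vec_eq_iff)
      moreover have "?B \<in> T" by (simp add: T_def)
      ultimately show "A \<in> L ` T" using imageI[of ?B T L] by simp
    qed
  qed
  also have "card P = CARD('m) choose 2"
  proof -
    have "(UNIV :: ('m \<times> 'm) set) = P \<union> prod.swap ` P \<union> range (\<lambda>i. (i, i))"
    proof (rule set_eqI, clarify)
      fix i j :: 'm
      show "(i, j) \<in> UNIV \<longleftrightarrow> (i, j) \<in> P \<union> prod.swap ` P \<union> range (\<lambda>i. (i, i))"
        using neq[of i j] by auto
    qed
    then have "card (UNIV :: ('m \<times> 'm) set) = card (P \<union> prod.swap ` P \<union> range (\<lambda>i. (i, i)))"
      by simp
    also have "\<dots> = card P + card (prod.swap ` P) + card (range (\<lambda>i::'m. (i, i)))"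
      by (subst card_Un_disjoint; (subst card_Un_disjoint)?) (auto simp: P_def)
    also have "card (prod.swap ` P) = card P"
      by (rule card_image) (auto simp: inj_on_def)
    also have "card (range (\<lambda>i::'m. (i, i))) = CARD('m)"
      by (rule card_image) (auto simp: inj_on_def)
    finally have "CARD('m) * CARD('m) = 2 * card P + CARD('m)"
      by (simp add: card_cartesian_product UNIV_Times_UNIV[symmetric] del: UNIV_Times_UNIV)
    then have "2 * card P = CARD('m) * (CARD('m) - 1)"
      by (simp add: diff_mult_distrib2)
    then show ?thesis by (simp add: choose_two)
  qed
  finally show ?thesis .
qed

section \<open>Rows of the rigidity matrix and their common kernel\<close>

definition point :: "real ^ ('v::finite \<times> 'm::finite) \<Rightarrow> 'v \<Rightarrow> real ^ 'm" where
  "point x v = (\<chi> j. x $ (v, j))"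

text \<open>Edges are unordered, so no endpoint can be named first. In the sum over \<open>e\<close>
  the term \<open>w = u\<close> vanishes, and for a pair only the difference to the other endpoint
  remains.\<close>

definition rig_row :: "real ^ ('v::finite \<times> 'm::finite) \<Rightarrow> 'v set \<Rightarrow> real ^ ('v \<times> 'm)" where
  "rig_row x e = (\<chi> c. case c of (u, j) \<Rightarrow> if u \<in> e then \<Sum>w\<in>e. x $ (u, j) - x $ (w, j) else 0)"

text \<open>The points affinely span the whole space; \<open>b\<close> is a base point.\<close>

definition spans_space :: "real ^ ('v::finite \<times> 'm::finite) \<Rightarrow> bool" where
  "spans_space x \<longleftrightarrow> (\<exists>b. span (range (\<lambda>v. point x v - point x b)) = UNIV)"

lemma inner_rig_row:
  "rig_row x e \<bullet> y = (\<Sum>u\<in>e. \<Sum>w\<in>e. (point x u - point x w) \<bullet> point y u)"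
proof -
  have "rig_row x e \<bullet> y = (\<Sum>u\<in>UNIV. \<Sum>j\<in>UNIV. rig_row x e $ (u, j) * y $ (u, j))"
    unfolding inner_vec_def UNIV_Times_UNIV[symmetric] sum.cartesian_product by (simp add: case_prod_beta)
  also have "\<dots> = (\<Sum>u\<in>UNIV. if u \<in> e then \<Sum>w\<in>e. (point x u - point x w) \<bullet> point y u else 0)"
  proof (rule sum.cong)
    fix u
    have "(\<Sum>j\<in>UNIV. (\<Sum>w\<in>e. x $ (u, j) - x $ (w, j)) * y $ (u, j))
      = (\<Sum>w\<in>e. (point x u - point x w) \<bullet> point y u)"
      unfolding sum_distrib_right by (subst sum.swap) (simp add: inner_vec_def point_def)
    then show "(\<Sum>j\<in>UNIV. rig_row x e $ (u, j) * y $ (u, j))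
      = (if u \<in> e then \<Sum>w\<in>e. (point x u - point x w) \<bullet> point y u else 0)"
      by (auto simp: rig_row_def)
  qed simp
  finally show ?thesis by (simp add: sum.If_cases)
qed

lemma inner_rig_row_pair:
  "v \<noteq> w \<Longrightarrow> rig_row x {v, w} \<bullet> y = (point x v - point x w) \<bullet> (point y v - point y w)"
  by (simp add: inner_rig_row inner_diff_left inner_diff_right)

text \<open>Expanding the double sum gives a visibly symmetric bilinear form. Its symmetry is what
  makes \<open>rig_row x e\<close> a gradient.\<close>

lemma rig_row_commute: "rig_row x e \<bullet> y = rig_row y e \<bullet> x"
proof -
  have *: "rig_row x e \<bullet> y = card e * (\<Sum>u\<in>e. point x u \<bullet> point y u)
      - (\<Sum>u\<in>e. point x u) \<bullet> (\<Sum>u\<in>e. point y u)" for x y :: "real ^ ('a \<times> 'b)"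
    unfolding inner_rig_row inner_sum_left inner_sum_right
    by (simp add: inner_diff_left sum_subtractf sum_distrib_left)
  show ?thesis unfolding * by (simp add: inner_commute)
qed

lemma bounded_linear_rig_row: "bounded_linear (\<lambda>x. rig_row x e)"
  unfolding linear_conv_bounded_linear[symmetric]
  by (rule linearI)
    (auto simp: rig_row_def vec_eq_iff sum.distrib[symmetric] sum_distrib_left algebra_simps
      intro!: sum.cong)

text \<open>For a pair \<open>e\<close> the function is half the squared edge length, the factor 1/2
  making the rigidity row its exact gradient.\<close>

lemma has_derivative_rig_row_quadratic:
  "((\<lambda>x. rig_row x e \<bullet> x / 2) has_derivative (\<lambda>h. rig_row x e \<bullet> h)) (at x)"
proof -
  have "((\<lambda>x. rig_row x e \<bullet> x / 2) has_derivative
     (\<lambda>h. (rig_row x e \<bullet> h + rig_row h e \<bullet> x) / 2)) (at x)"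
    by (auto intro!: derivative_eq_intros bounded_linear.has_derivative[OF bounded_linear_rig_row])
  then show ?thesis by (simp add: rig_row_commute[of _ _ x])
qed

text \<open>Velocities preserving all distances to first order are exactly \<open>A x + t\<close>
  with \<open>A\<close> skew and \<open>t\<close> a translation, and affine spanning makes
  \<open>(A, t)\<close> unique. The count is \<open>m choose 2\<close> plus
  \<open>m\<close>.\<close>

lemma dim_infinitesimal_isometries:
  fixes x :: "real ^ ('v::finite \<times> 'm::finite)"
  assumes "spans_space x"
  shows "dim {z. \<forall>e. card e = 2 \<longrightarrow> rig_row x e \<bullet> z = 0} = (CARD('m) + 1) choose 2"
proof -
  obtain b where b: "span (range (\<lambda>v. point x v - point x b)) = UNIV"
    using assms by (auto simp: spans_space_def)
  let ?Sk = "{A :: real ^ 'm ^ 'm. \<forall>i j. A $ i $ j + A $ j $ i = 0}"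
  define \<Phi> :: "(real ^ 'm ^ 'm) \<times> (real ^ 'm) \<Rightarrow> real ^ ('v \<times> 'm)"
    where "\<Phi> = (\<lambda>(A, t). \<chi> c. (A *v point x (fst c) + t) $ snd c)"
  have \<Phi>: "linear \<Phi>"
    by (rule linearI) (auto simp: \<Phi>_def vec_eq_iff matrix_vector_mult_add_rdistrib
        scaleR_matrix_vector_assoc[symmetric] algebra_simps)
  have pt: "point (\<Phi> (A, t)) v = A *v point x v + t" for A t v
    by (simp add: \<Phi>_def point_def vec_eq_iff)
  have sub: "subspace (?Sk \<times> (UNIV :: (real ^ 'm) set))"
    by (intro subspace_Times subspace_UNIV subspace_skew_matrices)
  have lin0: "A = 0" if "\<And>v. A *v (point x v - point x b) = 0" for A :: "real ^ 'm ^ 'm"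
  proof -
    have "A *v y = 0" for y
      by (rule linear_eq_0_on_span[of "(*v) A" "range (\<lambda>v. point x v - point x b)"])
        (auto simp: that b)
    then show ?thesis by (simp add: matrix_eq)
  qed
  have "inj_on \<Phi> (?Sk \<times> UNIV)"
    unfolding linear_inj_on_iff_eq_0[OF \<Phi> sub]
  proof clarify
    fix A :: "real ^ 'm ^ 'm" and t assume "\<Phi> (A, t) = 0"
    then have 0: "A *v point x v + t = 0" for v
      using pt[of A t v] by (simp add: point_def vec_eq_iff)
    have "A *v (point x v - point x b) = 0" for v
      using trans[OF 0[of v] 0[of b, symmetric]] by (simp add: matrix_vector_mult_diff_distrib)
    then have "A = 0" by (rule lin0)
    then show "(A, t) = 0" using 0[of b] by (simp add: zero_prod_def)
  qed
  then have "dim (\<Phi> ` (?Sk \<times> UNIV)) = dim (?Sk \<times> (UNIV :: (real ^ 'm) set))"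
    using sub by (intro dim_image_eq[OF \<Phi>]) (simp add: span_eq_iff[THEN iffD2])
  also have "\<dots> = dim ?Sk + CARD('m)"
    by (subst dim_Times) (simp_all add: subspace_skew_matrices)
  also have "\<dots> = (CARD('m) + 1) choose 2"
    unfolding dim_skew_matrices by (simp add: numeral_2_eq_2)
  also have "\<Phi> ` (?Sk \<times> UNIV) = {z. \<forall>e. card e = 2 \<longrightarrow> rig_row x e \<bullet> z = 0}" (is "_ = ?Z")
  proof
    show "\<Phi> ` (?Sk \<times> UNIV) \<subseteq> ?Z"
    proof clarify
      fix A :: "real ^ 'm ^ 'm" and t and e :: "'v set"
      assume A: "\<forall>i j. A $ i $ j + A $ j $ i = 0" and "card e = 2"
      then obtain v w where e: "e = {v, w}" "v \<noteq> w" by (auto simp: card_2_iff)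
      have "y \<bullet> (A *v y) = 0" for y
      proof -
        have "y \<bullet> (A *v y) = (\<Sum>i\<in>UNIV. \<Sum>j\<in>UNIV. y $ i * (A $ i $ j * y $ j))"
          by (simp add: inner_vec_def matrix_vector_mult_def sum_distrib_left)
        also have "\<dots> = (\<Sum>j\<in>UNIV. \<Sum>i\<in>UNIV. y $ i * (A $ i $ j * y $ j))"
          by (rule sum.swap)
        also have "\<dots> = - (\<Sum>j\<in>UNIV. \<Sum>i\<in>UNIV. y $ j * (A $ j $ i * y $ i))"
          unfolding sum_negf[symmetric]
        proof (intro sum.cong refl)
          fix i j show "y $ i * (A $ i $ j * y $ j) = - (y $ j * (A $ j $ i * y $ i))"
            using A[rule_format, of i j, unfolded add_eq_0_iff2] by simp
        qed
        also have "\<dots> = - (y \<bullet> (A *v y))"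
          by (simp add: inner_vec_def matrix_vector_mult_def sum_distrib_left)
        finally show ?thesis by simp
      qed
      then show "rig_row x e \<bullet> \<Phi> (A, t) = 0"
        using e by (simp add: inner_rig_row_pair pt matrix_vector_mult_diff_distrib[symmetric])
    qed
    show "?Z \<subseteq> \<Phi> ` (?Sk \<times> UNIV)"
    proof
      fix z assume z: "z \<in> ?Z"
      define a where "a v = point x v - point x b" for v
      define y where "y v = point z v - point z b" for v
      have z2: "(point x v - point x w) \<bullet> (point z v - point z w) = 0" for v w
        using z inner_rig_row_pair[of v w x z] by (cases "v = w") auto
      \<comment> \<open>Polarisation of \<open>z2\<close> over the three pairs formed by
        \<open>v\<close>, \<open>w\<close> and the base point \<open>b\<close>.\<close>
      have skew: "a v \<bullet> y w = - (y v \<bullet> a w)" for v w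
        using z2[of v w] z2[of v b] z2[of w b] unfolding a_def y_def
        by (simp add: inner_diff_left inner_diff_right inner_commute)
      have spa: "span (range a) = UNIV" using b by (simp add: a_def[abs_def])
      \<comment> \<open>By skewness a relation among the \<open>a v\<close> makes the same
        combination of the \<open>y v\<close> orthogonal to every \<open>a w\<close>, and these
        span.\<close>
      have "(\<Sum>v\<in>UNIV. c v *\<^sub>R y v) = 0" if "(\<Sum>v\<in>UNIV. c v *\<^sub>R a v) = 0" for c
      proof (rule eq_0_if_orthogonal_spanning[OF spa])
        fix r assume "r \<in> range a"
        then obtain w where r: "r = a w" by blast
        have "(\<Sum>v\<in>UNIV. c v *\<^sub>R y v) \<bullet> r = - ((\<Sum>v\<in>UNIV. c v *\<^sub>R a v) \<bullet> y w)"
          by (simp add: inner_sum_left r skew sum_negf)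
        then show "(\<Sum>v\<in>UNIV. c v *\<^sub>R y v) \<bullet> r = 0" using that by simp
      qed
      then obtain L where L: "linear L" "\<And>v. L (a v) = y v"
        using linear_map_on_spanning_family[OF spa] by blast
      have skewL: "u \<bullet> L w + L u \<bullet> w = 0" for u w
      proof -
        have 1: "a v \<bullet> L w + y v \<bullet> w = 0" for v w
        proof (rule linear_eq_0_on_span[of "\<lambda>w. a v \<bullet> L w + y v \<bullet> w" "range a"])
          show "linear (\<lambda>w. a v \<bullet> L w + y v \<bullet> w)"
            by (rule linearI) (simp_all add: linear_add[OF L(1)] linear_cmul[OF L(1)] inner_add_right algebra_simps)
        qed (auto simp: spa L skew)
        show ?thesis
        proof (rule linear_eq_0_on_span[of "\<lambda>u. u \<bullet> L w + L u \<bullet> w" "range a"])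
          show "linear (\<lambda>u. u \<bullet> L w + L u \<bullet> w)"
            by (rule linearI) (simp_all add: linear_add[OF L(1)] linear_cmul[OF L(1)] inner_add_left algebra_simps)
        qed (auto simp: spa L 1)
      qed
      let ?A = "matrix L"
      have "?A $ i $ j + ?A $ j $ i = 0" for i j
        using skewL[of "axis i 1" "axis j 1"]
        by (simp add: matrix_def inner_axis inner_axis' inner_commute)
      moreover have "\<Phi> (?A, point z b - ?A *v point x b) = z"
      proof -
        have "point (\<Phi> (?A, point z b - ?A *v point x b)) v = point z v" for v
        proof -
          have "?A *v point x v - ?A *v point x b = L (a v)"
            by (simp add: fun_cong[OF matrix_vector_mul(2)[OF L(1)]] linear_diff[OF L(1)] a_def)
          then show ?thesis by (simp add: pt L y_def algebra_simps)
        qed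
        then show ?thesis by (auto simp: point_def vec_eq_iff)
      qed
      ultimately show "z \<in> \<Phi> ` (?Sk \<times> UNIV)"
        by (intro image_eqI[of _ _ "(?A, point z b - ?A *v point x b)"]) auto
    qed
  qed
  finally show ?thesis .
qed

text \<open>Distances determine the inner products of positions relative to \<open>b\<close>, hence
  the norms of all their combinations. So relations carry over and the resulting linear map
  preserves norms.\<close>

lemma congruent_imp_isometry:
  fixes x q :: "real ^ ('v::finite \<times> 'm::finite)"
  assumes "spans_space x"
    and dist: "\<And>v w. dist (point x v) (point x w) = dist (point q v) (point q w)"
  obtains T where "\<And>y z. dist (T y) (T z) = dist y z" "\<And>v. point q v = T (point x v)"
proof -
  obtain b where b: "span (range (\<lambda>v. point x v - point x b)) = UNIV"
    using assms by (auto simp: spans_space_def)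
  define a where "a v = point x v - point x b" for v
  define y where "y v = point q v - point q b" for v
  have spa: "span (range a) = UNIV" using b by (simp add: a_def[abs_def])
  have inn: "a v \<bullet> a w = y v \<bullet> y w" for v w
  proof -
    have "norm (a v) = norm (y v)" "norm (a w) = norm (y w)" "norm (a v - a w) = norm (y v - y w)"
      using dist[of v b] dist[of w b] dist[of v w] by (simp_all add: a_def y_def dist_norm)
    then show ?thesis by (simp add: dot_norm_neg)
  qed
  have nrm: "norm (\<Sum>v\<in>UNIV. c v *\<^sub>R y v) = norm (\<Sum>v\<in>UNIV. c v *\<^sub>R a v)" for c
    by (simp add: norm_eq_sqrt_inner inner_sum_left inner_sum_right inn)
  have "(\<Sum>v\<in>UNIV. c v *\<^sub>R y v) = 0" if "(\<Sum>v\<in>UNIV. c v *\<^sub>R a v) = 0" for c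
    using nrm[of c] that by simp
  then obtain L where L: "linear L" "\<And>v. L (a v) = y v"
    using linear_map_on_spanning_family[OF spa] by blast
  have "norm (L z) = norm z" for z
  proof -
    \<comment> \<open>Several vertices may share a position; \<open>J\<close> keeps one index for
      each.\<close>
    obtain J where J: "inj_on a J" "range a = a ` J"
      using subset_image_inj[of "range a" a UNIV] by auto
    have "z \<in> span (a ` J)" using spa J(2) by simp
    then obtain u where "z = (\<Sum>y\<in>a ` J. u y *\<^sub>R y)"
      by (auto simp: span_finite)
    then have "z = (\<Sum>v\<in>J. u (a v) *\<^sub>R a v)" by (simp add: sum.reindex[OF J(1)])
    also have "\<dots> = (\<Sum>v\<in>UNIV. (if v \<in> J then u (a v) else 0) *\<^sub>R a v)"
      by (simp add: if_distrib[of "\<lambda>s. s *\<^sub>R _"] sum.If_cases cong: if_cong)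
    finally have z: "z = (\<Sum>v\<in>UNIV. (if v \<in> J then u (a v) else 0) *\<^sub>R a v)" .
    have "L z = (\<Sum>v\<in>UNIV. (if v \<in> J then u (a v) else 0) *\<^sub>R y v)"
      by (subst z) (simp only: linear_sum[OF L(1)] linear_cmul[OF L(1)] L(2))
    then have "norm (L z) = norm (\<Sum>v\<in>UNIV. (if v \<in> J then u (a v) else 0) *\<^sub>R a v)"
      by (simp only: nrm)
    then show ?thesis by (simp only: z[symmetric])
  qed
  then have "dist (point q b + L (s - point x b)) (point q b + L (t - point x b)) = dist s t" for s t
    by (simp add: dist_norm linear_diff[OF L(1), symmetric])
  moreover have "point q v = point q b + L (point x v - point x b)" for v
    using L(2)[of v] by (simp add: a_def y_def)
  ultimately show thesis
    using that[of "\<lambda>s. point q b + L (s - point x b)"] by blast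
qed

section \<open>Generic configurations\<close>

text \<open>
  The padding by the identity outside \<open>J\<close> makes the Gram determinant available for all subfamilies
  of one type; being a rational polynomial in the coordinates, it transfers independence from any
  configuration to the generic ones.
\<close>

definition gram_matrix :: "'i::finite set \<Rightarrow> ('i \<Rightarrow> 'a::real_inner) \<Rightarrow> real ^ 'i ^ 'i" where
  "gram_matrix J r = (\<chi> i j. if i \<in> J \<and> j \<in> J then r i \<bullet> r j else if i = j then 1 else 0)"

lemma gram_matrix_mult:
  "(gram_matrix J r *v x) $ i = (if i \<in> J then r i \<bullet> (\<Sum>j\<in>J. x $ j *\<^sub>R r j) else x $ i)"
proof (cases "i \<in> J")
  case True
  then have "(gram_matrix J r *v x) $ i = (\<Sum>j\<in>UNIV. if j \<in> J then x $ j * (r i \<bullet> r j) else 0)"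
    unfolding gram_matrix_def matrix_vector_mult_def by (auto intro!: sum.cong)
  then show ?thesis using True by (simp add: sum.If_cases inner_sum_right)
next
  case False
  then have "(gram_matrix J r *v x) $ i = (\<Sum>j\<in>UNIV. if i = j then x $ j else 0)"
    unfolding gram_matrix_def matrix_vector_mult_def
    by (simp add: if_distrib[of "\<lambda>s. s * _"] cong: if_cong)
  then show ?thesis using False by simp
qed

text \<open>The padding forces a kernel vector to vanish outside \<open>J\<close>; pairing it with
  its image gives the squared norm of the combination over \<open>J\<close>.\<close>

lemma indep_family_iff_gram: "indep_family J r \<longleftrightarrow> det (gram_matrix J r) \<noteq> 0"
proof -
  have "indep_family J r \<longleftrightarrow> (\<forall>x. gram_matrix J r *v x = 0 \<longrightarrow> x = 0)"
  proof (intro iffI allI impI)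
    fix x assume ind: "indep_family J r" and x: "gram_matrix J r *v x = 0"
    have c: "(if i \<in> J then r i \<bullet> (\<Sum>j\<in>J. x $ j *\<^sub>R r j) else x $ i) = 0" for i
      unfolding gram_matrix_mult[symmetric] x by simp
    have "(\<Sum>j\<in>J. x $ j *\<^sub>R r j) \<bullet> (\<Sum>j\<in>J. x $ j *\<^sub>R r j)
        = (\<Sum>i\<in>J. x $ i * (r i \<bullet> (\<Sum>j\<in>J. x $ j *\<^sub>R r j)))"
      by (subst inner_sum_left) simp
    also have "\<dots> = 0"
      using c by (intro sum.neutral ballI) (metis mult_zero_right)
    finally have "(\<Sum>j\<in>J. x $ j *\<^sub>R r j) = 0" by simp
    then have "\<forall>i\<in>J. x $ i = 0"
      using ind[unfolded indep_family_def, rule_format, of "\<lambda>i. x $ i"] by blast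
    then show "x = 0" using c by (metis vec_eq_iff zero_index)
  next
    assume *: "\<forall>x. gram_matrix J r *v x = 0 \<longrightarrow> x = 0"
    show "indep_family J r"
      unfolding indep_family_def
    proof (intro allI impI ballI)
      fix c i assume 0: "(\<Sum>i\<in>J. c i *\<^sub>R r i) = 0" and i: "i \<in> J"
      let ?x = "\<chi> i. if i \<in> J then c i else 0"
      have "(\<Sum>j\<in>J. ?x $ j *\<^sub>R r j) = 0" using 0 by simp
      then have "gram_matrix J r *v ?x = 0"
        unfolding vec_eq_iff gram_matrix_mult by simp
      then have "?x = 0" using * by blast
      then have "?x $ i = 0" by simp
      then show "c i = 0" using i by simp
    qed
  qed
  then show ?thesis
    by (simp add: invertible_det_nz[symmetric] invertible_left_inverse matrix_left_invertible_ker)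
qed

lemma rat_poly_fun_rig_row: "rat_poly_fun (\<lambda>z. rig_row (\<chi> c. z c) e $ c)"
proof (cases c)
  case (Pair u j)
  then show ?thesis
    by (cases "u \<in> e")
      (auto simp: rig_row_def rat_poly_fun_of_int[of 0, simplified]
        intro!: rat_poly_fun_sum rat_poly_fun_diff rat_poly_fun_var)
qed

lemma generic_indep_family:
  fixes x y :: "real ^ ('v::finite \<times> 'm::finite)"
  assumes "alg_indep_over_rat (($) x)" "indep_family J (rig_row y)"
  shows "indep_family J (rig_row x)"
proof -
  let ?f = "\<lambda>z :: 'v \<times> 'm \<Rightarrow> real. det (gram_matrix J (rig_row (\<chi> c. z c)))"
  have "rat_poly_fun ?f"
  proof (rule rat_poly_fun_det)
    fix i j
    show "rat_poly_fun (\<lambda>z :: 'v \<times> 'm \<Rightarrow> real. gram_matrix J (rig_row (\<chi> c. z c)) $ i $ j)"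
    proof (cases "i \<in> J \<and> j \<in> J")
      case True
      then show ?thesis
        by (simp add: gram_matrix_def inner_vec_def
            rat_poly_fun_sum rat_poly_fun_mult rat_poly_fun_rig_row)
    next
      case False
      then have "gram_matrix J (rig_row (\<chi> c. z c)) $ i $ j = of_int (if i = j then 1 else 0)"
        for z :: "'v \<times> 'm \<Rightarrow> real"
        by (auto simp: gram_matrix_def)
      then show ?thesis
        by (simp only: rat_poly_fun_of_int)
    qed
  qed
  then have "?f (($) x) = 0 \<Longrightarrow> ?f (($) y) = 0"
    using rat_poly_fun_eq_0[OF assms(1)] by blast
  then show ?thesis
    using assms(2) by (auto simp: indep_family_iff_gram)
qed

text \<open>Supplies the neighbourhood on which the constant rank theorem is applied.\<close>

lemma open_indep_family_rig_row: "open {x :: real ^ ('v::finite \<times> 'm::finite). indep_family J (rig_row x)}"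
proof -
  have "continuous_on UNIV (\<lambda>x :: real ^ ('v \<times> 'm). gram_matrix J (rig_row x) $ i $ j)" for i j
    by (cases "i \<in> J"; cases "j \<in> J")
      (simp_all add: gram_matrix_def continuous_on_inner continuous_on_const
        bounded_linear.continuous_on[OF bounded_linear_rig_row continuous_on_id])
  then have "continuous_on UNIV (\<lambda>x :: real ^ ('v \<times> 'm). det (gram_matrix J (rig_row x)))"
    unfolding det_def by (intro continuous_on_sum continuous_on_mult continuous_on_prod continuous_on_const)
  then show ?thesis
    unfolding indep_family_iff_gram by (intro open_Collect_neq continuous_on_const)
qed

text \<open>Otherwise \<open>J\<close> together with \<open>e\<close> would be independent at
  \<open>q\<close>, hence also at the generic \<open>x\<close>. Thus the rank cannot jump near a
  generic configuration.\<close>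

lemma generic_span_rig_row:
  fixes x q :: "real ^ ('v::finite \<times> 'm::finite)"
  assumes "alg_indep_over_rat (($) x)" "indep_family J (rig_row q)"
    and e: "rig_row x e \<in> span (rig_row x ` J)"
  shows "rig_row q e \<in> span (rig_row q ` J)"
proof (cases "e \<in> J")
  case False
  show ?thesis
  proof (rule ccontr)
    assume "rig_row q e \<notin> span (rig_row q ` J)"
    then have "indep_family (insert e J) (rig_row q)"
      by (rule indep_family_insert[OF finite_class.finite assms(2)])
    from generic_indep_family[OF assms(1) this]
    have inj: "inj_on (rig_row x) (insert e J)" and ind: "independent (rig_row x ` insert e J)"
      by (simp_all add: indep_family_iff)
    have "rig_row x e \<notin> rig_row x ` J"
      using inj False by (auto simp: inj_on_def)
    then show False
      using ind e by (simp add: independent_insert)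
  qed
qed (simp add: span_base)

text \<open>Affine spanning by a base point and \<open>m\<close> further vertices is the
  non-vanishing of a determinant, so one good placement suffices.\<close>

lemma generic_spans_space:
  fixes x :: "real ^ ('v::finite \<times> 'm::finite)"
  assumes gen: "alg_indep_over_rat (($) x)" and card: "CARD('m) < CARD('v)"
  shows "spans_space x"
proof -
  fix b :: 'v
  have "CARD('m) \<le> card (UNIV - {b})"
    using card by (simp add: card_Diff_singleton)
  then obtain f :: "'m \<Rightarrow> 'v" where f: "range f \<subseteq> UNIV - {b}" "inj f"
    using card_le_inj[of "UNIV :: 'm set" "UNIV - {b}"] by auto
  let ?M = "\<lambda>z. \<chi> i j. z (f i, j) - z (b, j) :: real ^ 'm ^ 'm"
  have "rat_poly_fun (\<lambda>z. det (?M z))"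
    by (rule rat_poly_fun_det) (auto intro!: rat_poly_fun_diff rat_poly_fun_var)
  \<comment> \<open>The test placement puts \<open>f j\<close> at the \<open>j\<close>-th unit
    vector and all other vertices, \<open>b\<close> among them, at the origin.\<close>
  moreover have "?M (\<lambda>(v, j). if v = f j then 1 else 0) = mat 1"
    using f by (auto simp: mat_def vec_eq_iff inj_def)
  then have "det (?M (\<lambda>(v, j). if v = f j then 1 else 0)) \<noteq> 0"
    by simp
  ultimately have "det (?M (($) x)) \<noteq> 0"
    using rat_poly_fun_eq_0[OF gen] by blast
  then have "span (rows (?M (($) x))) = UNIV"
    by (simp add: invertible_det_nz[symmetric] invertible_left_inverse matrix_left_invertible_span_rows)
  moreover have "rows (?M (($) x)) \<subseteq> range (\<lambda>v. point x v - point x b)"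
    by (auto simp: rows_def row_def point_def vec_eq_iff image_iff)
  ultimately have "span (range (\<lambda>v. point x v - point x b)) = UNIV"
    using span_mono by blast
  then show ?thesis by (auto simp: spans_space_def)
qed

section \<open>Rank and nullity of the rigidity matrix\<close>

lemma dim_plus_dim_orthogonal:
  fixes S :: "'a::euclidean_space set"
  shows "dim S + dim {z. \<forall>s\<in>S. s \<bullet> z = 0} = DIM('a)"
proof -
  have "{z \<in> UNIV. \<forall>s\<in>span S. orthogonal s z} = {z. \<forall>s\<in>S. s \<bullet> z = 0}"
  proof safe
    fix z s assume "\<forall>s\<in>span S. orthogonal s z" "s \<in> S"
    then show "s \<bullet> z = 0" using span_base[of s S] by (simp add: orthogonal_def)
  next
    fix z s assume z: "\<forall>s\<in>S. s \<bullet> z = 0" and s: "s \<in> span S"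
    have "orthogonal z s"
      using s by (rule orthogonal_to_span) (use z in \<open>simp add: orthogonal_def inner_commute\<close>)
    then show "orthogonal s z" by (simp add: orthogonal_commute)
  qed simp
  with dim_subspace_orthogonal_to_vectors[of "span S" UNIV] show ?thesis by simp
qed

lemma dim_rig_rows_complete:
  fixes x :: "real ^ ('v::finite \<times> 'm::finite)"
  assumes "spans_space x"
  shows "dim (rig_row x ` {e. card e = 2}) + ((CARD('m) + 1) choose 2) = CARD('m) * CARD('v)"
proof -
  have "{z. \<forall>s\<in>rig_row x ` {e. card e = 2}. s \<bullet> z = 0}
      = {z. \<forall>e. card e = 2 \<longrightarrow> rig_row x e \<bullet> z = 0}"
    by auto
  then show ?thesis
    using dim_plus_dim_orthogonal[of "rig_row x ` {e. card e = 2}"]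
    by (simp add: dim_infinitesimal_isometries[OF assms] mult.commute)
qed

section \<open>Placements as points of one Euclidean space\<close>

definition config :: "('v::finite \<Rightarrow> real ^ 'm::finite) \<Rightarrow> real ^ ('v \<times> 'm)" where
  "config p = (\<chi> c. p (fst c) $ snd c)"

lemma point_config [simp]: "point (config p) v = p v"
  by (simp add: point_def config_def vec_eq_iff)

lemma config_point [simp]: "config (point x) = x"
  by (simp add: point_def config_def vec_eq_iff)

lemma generic_iff_config: "generic p \<longleftrightarrow> alg_indep_over_rat (($) (config p))"
proof -
  have "(\<lambda>(v, i). p v $ i) = ($) (config p)"
    by (auto simp: config_def)
  then show ?thesis by (simp add: generic_def)
qed

lemma dist_point_le: "dist (point x v) (point y v) \<le> dist x y"
proof -
  have "(\<Sum>j\<in>UNIV. (dist (x $ (v, j)) (y $ (v, j)))\<^sup>2)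
      = (\<Sum>c\<in>Pair v ` UNIV. (dist (x $ c) (y $ c))\<^sup>2)"
    by (subst sum.reindex) (auto simp: inj_on_def)
  also have "\<dots> \<le> (\<Sum>c\<in>UNIV. (dist (x $ c) (y $ c))\<^sup>2)"
    by (rule sum_mono2) auto
  finally show ?thesis
    by (simp add: dist_vec_def L2_set_def point_def)
qed

text \<open>A crude constant is enough: it only turns closeness at each vertex into closeness of
  configurations.\<close>

lemma dist_config_le:
  fixes p q :: "'v::finite \<Rightarrow> real ^ 'm::finite"
  assumes "\<And>v. dist (p v) (q v) \<le> \<delta>"
  shows "dist (config p) (config q) \<le> of_nat (CARD('v) * CARD('m)) * \<delta>"
proof -
  have "dist (config p) (config q) \<le> (\<Sum>c\<in>UNIV. \<bar>(config p - config q) $ c\<bar>)"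
    unfolding dist_norm by (rule norm_le_l1_cart)
  also have "\<dots> \<le> (\<Sum>c\<in>(UNIV :: ('v \<times> 'm) set). \<delta>)"
  proof (rule sum_mono)
    fix c :: "'v \<times> 'm"
    have "\<bar>(config p - config q) $ c\<bar> \<le> dist (p (fst c)) (q (fst c))"
      using component_le_norm_cart[of "p (fst c) - q (fst c)" "snd c"]
      by (simp add: config_def dist_norm)
    also have "\<dots> \<le> \<delta>" by (rule assms)
    finally show "\<bar>(config p - config q) $ c\<bar> \<le> \<delta>" .
  qed
  finally show ?thesis by simp
qed

lemma rig_row_pair_self:
  "v \<noteq> w \<Longrightarrow> rig_row x {v, w} \<bullet> x = (dist (point x v) (point x w))\<^sup>2"
  by (simp add: inner_rig_row_pair dist_norm power2_norm_eq_inner)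

section \<open>Rigidity and the rank of the rigidity matrix\<close>

text \<open>Independence of the rows in \<open>J\<close> is an open condition and, \<open>x\<close>
  being generic, keeps every row of \<open>K\<close> in their span; these are the constant rank
  hypotheses.\<close>

lemma generic_level_set:
  fixes x :: "real ^ ('v::finite \<times> 'm::finite)"
  assumes x: "alg_indep_over_rat (($) x)" and J: "J \<subseteq> K" "indep_family J (rig_row x)"
    and K: "rig_row x ` K \<subseteq> span (rig_row x ` J)"
  obtains W where "open W" "x \<in> W"
    "\<And>q. q \<in> W \<Longrightarrow> (\<forall>e\<in>J. rig_row q e \<bullet> q / 2 = rig_row x e \<bullet> x / 2) \<Longrightarrow>
       (\<forall>e\<in>K. rig_row q e \<bullet> q / 2 = rig_row x e \<bullet> x / 2)"
    "\<And>u. (\<forall>e\<in>J. rig_row x e \<bullet> u = 0) \<Longrightarrow>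
       \<exists>\<gamma>. \<gamma> 0 = x \<and> (\<gamma> has_vector_derivative u) (at 0) \<and>
         (\<forall>\<^sub>F t in at 0. \<forall>e\<in>K. rig_row (\<gamma> t) e \<bullet> \<gamma> t / 2 = rig_row x e \<bullet> x / 2)"
proof (rule constant_rank_level_set[of J K "{q. indep_family J (rig_row q)}" x
      "\<lambda>e q. rig_row q e \<bullet> q / 2" "\<lambda>e q. rig_row q e"])
  show "indep_family J (\<lambda>e. rig_row x e)" "x \<in> {q. indep_family J (rig_row q)}"
    using J(2) by simp_all
  show "open {q :: real ^ ('v \<times> 'm). indep_family J (rig_row q)}"
    by (rule open_indep_family_rig_row)
  show "rig_row q e \<in> span ((\<lambda>e. rig_row q e) ` J)"
    if "e \<in> K" "q \<in> {q. indep_family J (rig_row q)}" for e and q :: "real ^ ('v \<times> 'm)"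
  proof -
    have "rig_row x e \<in> span (rig_row x ` J)" using K that(1) by blast
    then show ?thesis
      using that(2) generic_span_rig_row[OF x, of J q e] by simp
  qed
  show "((\<lambda>q. rig_row q e \<bullet> q / 2) has_derivative (\<lambda>h. rig_row q e \<bullet> h)) (at q)"
    for e and q :: "real ^ ('v \<times> 'm)"
    by (rule has_derivative_rig_row_quadratic)
  show "continuous_on {q :: real ^ ('v \<times> 'm). indep_family J (rig_row q)} (\<lambda>q. rig_row q e)" for e
    by (rule bounded_linear.continuous_on[OF bounded_linear_rig_row continuous_on_id])
  show "finite J" "J \<subseteq> K" using J(1) by simp_all
qed (rule that)

text \<open>An infinitesimal flex \<open>u\<close> integrates to a curve of equivalent frameworks.
  Rigidity makes them congruent to \<open>p\<close>, so the length of every pair is constant along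
  the curve, and differentiating at 0 gives the claim.\<close>

lemma rigid_framework_imp_rig_row_orthogonal:
  fixes p :: "'v::finite \<Rightarrow> real ^ 'm::finite"
  assumes gen: "generic p" and E: "simple_graph E" and rigid: "rigid_framework E p"
    and u: "\<forall>e\<in>E. rig_row (config p) e \<bullet> u = 0" and e: "card e = 2"
  shows "rig_row (config p) e \<bullet> u = 0"
proof -
  define x where "x = config p"
  have x: "alg_indep_over_rat (($) x)" using gen by (simp add: x_def generic_iff_config)
  obtain J where J: "J \<subseteq> E" "indep_family J (rig_row x)" "rig_row x ` E \<subseteq> span (rig_row x ` J)"
    using indep_family_spanning_subset[OF finite_class.finite] by metis
  let ?f = "\<lambda>e q. rig_row q e \<bullet> q / 2"
  have "\<forall>e\<in>J. rig_row x e \<bullet> u = 0" using u J(1) x_def by blast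
  then obtain \<gamma> where \<gamma>: "\<gamma> 0 = x" "(\<gamma> has_vector_derivative u) (at 0)"
    "\<forall>\<^sub>F t in at 0. \<forall>e\<in>E. ?f e (\<gamma> t) = ?f e x"
    by - (rule generic_level_set[OF x J], blast)
  obtain \<epsilon> where eps: "\<epsilon> > 0" and T: "\<And>q. (\<forall>v. dist (p v) (q v) < \<epsilon>) \<Longrightarrow>
      equivalent_frameworks E p q \<Longrightarrow>
      (\<exists>T. (\<forall>x y. dist (T x) (T y) = dist x y) \<and> (\<forall>v. q v = T (p v)))"
    using rigid unfolding rigid_framework_def by blast
  obtain a b where ab: "e = {a, b}" "a \<noteq> b" using e by (auto simp: card_2_iff)
  have "(\<gamma> \<longlongrightarrow> x) (at 0)"
    using has_vector_derivative_continuous[OF \<gamma>(2)] \<gamma>(1) by (simp add: continuous_at)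
  then have "\<forall>\<^sub>F t in at 0. dist (\<gamma> t) x < \<epsilon>"
    using eps by (rule tendstoD)
  with \<gamma>(3) have ev: "\<forall>\<^sub>F t in at 0. ?f e x = ?f e (\<gamma> t)"
  proof (rule eventually_elim2)
    fix t assume t: "\<forall>e\<in>E. ?f e (\<gamma> t) = ?f e x" and d: "dist (\<gamma> t) x < \<epsilon>"
    have "dist (p v) (point (\<gamma> t) v) < \<epsilon>" for v
      using dist_point_le[of x v "\<gamma> t"] d by (simp add: x_def dist_commute)
    moreover have "equivalent_frameworks E p (point (\<gamma> t))"
      unfolding equivalent_frameworks_def
    proof (intro allI impI)
      fix v w assume vw: "{v, w} \<in> E"
      then have "card {v, w} = 2" using E by (simp add: simple_graph_def)
      then have "v \<noteq> w" by auto
      then have "(dist (point (\<gamma> t) v) (point (\<gamma> t) w))\<^sup>2 = (dist (point x v) (point x w))\<^sup>2"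
        using t vw by (simp add: rig_row_pair_self[symmetric])
      then show "dist (p v) (p w) = dist (point (\<gamma> t) v) (point (\<gamma> t) w)"
        by (simp add: x_def)
    qed
    ultimately obtain T where "\<And>x y. dist (T x) (T y) = dist x y" "\<And>v. point (\<gamma> t) v = T (p v)"
      using T[of "point (\<gamma> t)"] by blast
    then show "?f e x = ?f e (\<gamma> t)"
      using ab by (simp add: rig_row_pair_self x_def)
  qed
  have "((\<lambda>t. ?f e (\<gamma> t)) has_derivative (\<lambda>s. rig_row x e \<bullet> (s *\<^sub>R u))) (at 0)"
    using has_derivative_compose[OF \<gamma>(2)[unfolded has_vector_derivative_def]]
      has_derivative_rig_row_quadratic[of e x] \<gamma>(1) by blast
  moreover have "((\<lambda>t. ?f e (\<gamma> t)) has_derivative (\<lambda>s. 0)) (at 0)"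
    by (rule has_derivative_transform_eventually[OF has_derivative_const ev]) (simp_all add: \<gamma>(1))
  ultimately have "(\<lambda>s. rig_row x e \<bullet> (s *\<^sub>R u)) = (\<lambda>s. 0)"
    by (rule has_derivative_unique)
  from fun_cong[OF this, of 1] show ?thesis by (simp add: x_def)
qed

text \<open>When the rows of \<open>E\<close> span those of all pairs, nearby configurations with
  the same edge lengths agree in all distances and are therefore congruent to
  \<open>p\<close>.\<close>

lemma rigid_framework_if_rig_row_span:
  fixes p :: "'v::finite \<Rightarrow> real ^ 'm::finite"
  assumes gen: "generic p" and sp: "spans_space (config p)" and E: "simple_graph E"
    and K: "rig_row (config p) ` {e. card e = 2} \<subseteq> span (rig_row (config p) ` E)"
  shows "rigid_framework E p"
proof -
  define x where "x = config p"
  have x: "alg_indep_over_rat (($) x)" using gen by (simp add: x_def generic_iff_config)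
  obtain J where J: "J \<subseteq> E" "indep_family J (rig_row x)" "rig_row x ` E \<subseteq> span (rig_row x ` J)"
    using indep_family_spanning_subset[OF finite_class.finite] by metis
  have "span (rig_row x ` E) \<subseteq> span (rig_row x ` J)"
    using J(3) by (rule span_minimal) simp
  then have KJ: "rig_row x e \<in> span (rig_row x ` J)" if "card e = 2" for e
    using K that x_def by blast
  let ?f = "\<lambda>e q. rig_row q e \<bullet> q / 2"
  obtain W where W: "open W" "x \<in> W"
    "\<And>q. q \<in> W \<Longrightarrow> (\<forall>e\<in>J. ?f e q = ?f e x) \<Longrightarrow> (\<forall>e\<in>{e. card e = 2}. ?f e q = ?f e x)"
  proof (rule generic_level_set[OF x _ J(2)])
    show "J \<subseteq> {e. card e = 2}" using J(1) E by (auto simp: simple_graph_def)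
    show "rig_row x ` {e. card e = 2} \<subseteq> span (rig_row x ` J)" using KJ by blast
  qed (rule that)
  obtain \<epsilon> where eps: "\<epsilon> > 0" "ball x \<epsilon> \<subseteq> W" using W(1,2) openE by blast
  define N where "N = real (CARD('v) * CARD('m))"
  have N: "N > 0" by (simp add: N_def)
  show ?thesis
    unfolding rigid_framework_def
  \<comment> \<open>\<open>N\<close> absorbs the passage from vertices to configurations, and the
    factor 2 makes the final inequality strict.\<close>
  proof (intro exI[of _ "\<epsilon> / (2 * N)"] conjI allI impI)
    show "\<epsilon> / (2 * N) > 0" using eps N by simp
    fix q assume q: "(\<forall>v. dist (p v) (q v) < \<epsilon> / (2 * N)) \<and> equivalent_frameworks E p q"
    have "dist x (config q) \<le> N * (\<epsilon> / (2 * N))"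
      unfolding x_def N_def by (rule dist_config_le) (use q in \<open>auto simp: N_def intro: less_imp_le\<close>)
    also have "\<dots> < \<epsilon>" using N eps by (simp add: field_simps)
    finally have "config q \<in> W" using eps(2) by auto
    moreover have "?f e (config q) = ?f e x" if "e \<in> J" for e
    proof -
      have "e \<in> E" using that J(1) by blast
      then obtain v w where "e = {v, w}" "v \<noteq> w"
        using E by (auto simp: simple_graph_def card_2_iff)
      then show ?thesis
        using q \<open>e \<in> E\<close> by (auto simp: rig_row_pair_self x_def equivalent_frameworks_def)
    qed
    ultimately have *: "?f e (config q) = ?f e x" if "card e = 2" for e
      using W(3)[of "config q"] that by blast
    have "dist (point x v) (point x w) = dist (point (config q) v) (point (config q) w)" for v w
    proof (cases "v = w")
      case False
      then have "(dist (point x v) (point x w))\<^sup>2 = (dist (point (config q) v) (point (config q) w))\<^sup>2"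
        using *[of "{v, w}"] by (simp add: rig_row_pair_self)
      then show ?thesis by simp
    qed simp
    then obtain T where "\<And>y z. dist (T y) (T z) = dist y z" "\<And>v. point (config q) v = T (point x v)"
      using congruent_imp_isometry[of x "config q"] sp x_def by blast
    then show "\<exists>T. (\<forall>x y. dist (T x) (T y) = dist x y) \<and> (\<forall>v. q v = T (p v))"
      by (auto simp: x_def)
  qed
qed

text \<open>Rigidity means that \<open>E\<close> has the same kernel, equivalently the same rank, as
  all pairs, and the latter rank is known from the trivial motions.\<close>

lemma rigid_framework_iff_rank:
  fixes p :: "'v::finite \<Rightarrow> real ^ 'm::finite"
  assumes gen: "generic p" and sp: "spans_space (config p)" and E: "simple_graph E"
  shows "rigid_framework E p \<longleftrightarrow>
    dim (rig_row (config p) ` E) + ((CARD('m) + 1) choose 2) = CARD('m) * CARD('v)"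
proof -
  let ?K = "{e :: 'v set. card e = 2}"
  let ?r = "rig_row (config p)"
  have EK: "E \<subseteq> ?K" using E by (auto simp: simple_graph_def)
  have "rigid_framework E p \<longleftrightarrow> dim (?r ` E) = dim (?r ` ?K)"
  proof
    assume "rigid_framework E p"
    then have "{z. \<forall>s\<in>?r ` E. s \<bullet> z = 0} = {z. \<forall>s\<in>?r ` ?K. s \<bullet> z = 0}"
      using EK rigid_framework_imp_rig_row_orthogonal[OF gen E] by blast
    then show "dim (?r ` E) = dim (?r ` ?K)"
      using dim_plus_dim_orthogonal[of "?r ` E"] dim_plus_dim_orthogonal[of "?r ` ?K"] by simp
  next
    assume d: "dim (?r ` E) = dim (?r ` ?K)"
    have "span (?r ` E) = span (?r ` ?K)"
      using d EK by (intro dim_eq_span) auto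
    then have "?r ` ?K \<subseteq> span (?r ` E)"
      using span_superset[of "?r ` ?K"] by simp
    then show "rigid_framework E p"
      by (rule rigid_framework_if_rig_row_span[OF gen sp E])
  qed
  then show ?thesis using dim_rig_rows_complete[OF sp] by linarith
qed

text \<open>An independent set of rows at \<open>x\<close> stays independent at a generic
  \<open>y\<close>, where the rank of all pairs bounds the rank from above. Hence an inequality at
  one arbitrary configuration suffices.\<close>

lemma graph_rigid_iff_rank:
  fixes E :: "'v::finite set set"
  assumes card: "CARD('m::finite) < CARD('v)" and E: "simple_graph E"
  shows "graph_rigid TYPE('m) E \<longleftrightarrow>
    (\<exists>x :: real ^ ('v \<times> 'm).
       dim (rig_row x ` E) + ((CARD('m) + 1) choose 2) \<ge> CARD('m) * CARD('v))"
proof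
  assume "graph_rigid TYPE('m) E"
  then obtain p :: "'v \<Rightarrow> real ^ 'm" where p: "generic p" "rigid_framework E p"
    by (auto simp: graph_rigid_def)
  then have "spans_space (config p)"
    using generic_spans_space card by (simp add: generic_iff_config)
  then show "\<exists>x :: real ^ ('v \<times> 'm).
       dim (rig_row x ` E) + ((CARD('m) + 1) choose 2) \<ge> CARD('m) * CARD('v)"
    using p rigid_framework_iff_rank[OF p(1) _ E] by (metis order_refl)
next
  assume "\<exists>x :: real ^ ('v \<times> 'm).
       dim (rig_row x ` E) + ((CARD('m) + 1) choose 2) \<ge> CARD('m) * CARD('v)"
  then obtain x :: "real ^ ('v \<times> 'm)"
    where x: "dim (rig_row x ` E) + ((CARD('m) + 1) choose 2) \<ge> CARD('m) * CARD('v)" ..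
  obtain z :: "'v \<times> 'm \<Rightarrow> real" where z: "alg_indep_over_rat z"
    using alg_indep_over_rat_exists by blast
  define y where "y = vec_lambda z"
  have "($) y = z" by (rule ext) (simp add: y_def)
  then have y: "alg_indep_over_rat (($) y)" using z by simp
  have sp: "spans_space y" using generic_spans_space[OF y card] .
  obtain J where J: "J \<subseteq> E" "indep_family J (rig_row x)" "card J = dim (rig_row x ` E)"
    using indep_family_spanning_subset[OF finite_class.finite] by metis
  have "dim (rig_row x ` E) = dim (rig_row y ` J)"
    using J generic_indep_family[OF y J(2)] by (simp add: dim_indep_family)
  moreover have "dim (rig_row y ` J) \<le> dim (rig_row y ` E)"
    using J(1) by (intro dim_subset image_mono)
  moreover have "dim (rig_row y ` E) \<le> dim (rig_row y ` {e. card e = 2})"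
    using E by (intro dim_subset image_mono) (auto simp: simple_graph_def)
  ultimately have "dim (rig_row y ` E) + ((CARD('m) + 1) choose 2) = CARD('m) * CARD('v)"
    using x dim_rig_rows_complete[OF sp] by linarith
  moreover have "generic (point y)" using y by (simp add: generic_iff_config)
  ultimately have "rigid_framework E (point y)"
    using rigid_framework_iff_rank[of "point y" E] sp E by simp
  with \<open>generic (point y)\<close> show "graph_rigid TYPE('m) E"
    unfolding graph_rigid_def by blast
qed

section \<open>The rank of \<open>J\<close>\<close>

text \<open>The squared difference along an edge, in the double sum shape that arises when an edge
  row of \<open>J\<close> is paired with a multiple of one coordinate of \<open>p\<close>.\<close>

definition edge_sq :: "('v \<Rightarrow> real) \<Rightarrow> 'v set \<Rightarrow> real" where
  "edge_sq f e = (\<Sum>u\<in>e. \<Sum>w\<in>e. (f u - f w) * f u)"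

lemma edge_sq_pair: "v \<noteq> w \<Longrightarrow> edge_sq f {v, w} = (f v - f w)\<^sup>2"
  by (simp add: edge_sq_def power2_eq_square algebra_simps)

text \<open>Allows a coordinate to be moved away from 0 at \<open>v0\<close>, as the matrix
  \<open>J\<close> demands, without affecting the rank.\<close>

lemma edge_sq_shift: "edge_sq (\<lambda>v. f v + c) e = edge_sq f e"
proof -
  have "(\<Sum>u\<in>e. \<Sum>w\<in>e. (f u - f w) * c) = 0"
    by (simp add: sum_subtractf left_diff_distrib sum_distrib_right[symmetric])
      (simp add: sum_distrib_left sum_distrib_right mult_ac)
  then show ?thesis
    by (simp add: edge_sq_def distrib_left sum.distrib)
qed

lemma edge_sq_zero [simp]: "edge_sq (\<lambda>v. 0) e = 0"
  by (simp add: edge_sq_def)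

text \<open>Polarisation with the indicators of \<open>v\<close>, of \<open>w\<close> and of both
  cancels on every edge except \<open>e0\<close>, where it gives 2. It reads off an off-diagonal
  entry of the weighted Laplacian.\<close>

lemma edge_sq_separates:
  fixes E :: "'v::finite set set"
  assumes E: "simple_graph E" and e0: "e0 \<in> E" "\<omega> e0 \<noteq> 0"
  obtains f where "(\<Sum>e\<in>E. \<omega> e * edge_sq f e) \<noteq> 0"
proof -
  obtain v w where vw: "e0 = {v, w}" "v \<noteq> w"
    using E e0 by (auto simp: simple_graph_def card_2_iff)
  let ?S = "\<lambda>f. \<Sum>e\<in>E. \<omega> e * edge_sq f e"
  let ?v = "\<lambda>a. if a = v then 1 else 0" and ?w = "\<lambda>a. if a = w then 1 else 0"
    and ?vw = "\<lambda>a. if a = v \<or> a = w then 1 else 0"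
  have "edge_sq ?v e + edge_sq ?w e - edge_sq ?vw e = (if e = e0 then 2 else 0)" if e: "e \<in> E" for e
  proof -
    obtain a b where ab: "e = {a, b}" "a \<noteq> b"
      using E e by (auto simp: simple_graph_def card_2_iff)
    then show ?thesis
      using vw by (auto simp: edge_sq_pair doubleton_eq_iff)
  qed
  then have "?S ?v + ?S ?w - ?S ?vw = (\<Sum>e\<in>E. \<omega> e * (if e = e0 then 2 else 0))"
    by (simp add: sum.distrib[symmetric] sum_subtractf[symmetric] distrib_left[symmetric]
        right_diff_distrib[symmetric])
  also have "\<dots> = 2 * \<omega> e0"
    using e0(1) by (simp add: if_distrib[of "\<lambda>s. _ * s"] cong: if_cong)
  finally have "?S ?v \<noteq> 0 \<or> ?S ?w \<noteq> 0 \<or> ?S ?vw \<noteq> 0"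
    using e0(2) by linarith
  then show thesis using that by blast
qed

definition ext_row ::
  "real ^ ('v::finite \<times> 'm::finite) \<Rightarrow> ('k::finite \<Rightarrow> 'v \<Rightarrow> real) \<Rightarrow> 'v set \<Rightarrow>
     (real ^ ('v \<times> 'm)) \<times> (real ^ 'k)" where
  "ext_row x X e = (rig_row x e, \<chi> i. edge_sq (X i) e)"

text \<open>Columns are filled one at a time. Since unfilled ones are zero, filling column
  \<open>i\<close> adds to the rows multiples of a single vector \<open>a\<close> that lies outside
  their span.\<close>

lemma ext_row_dim_attained:
  fixes E :: "'v::finite set set" and I :: "'k::finite set"
    and x :: "real ^ ('v \<times> 'm::finite)"
  assumes E: "simple_graph E"
  shows "dim (rig_row x ` E) + card I \<le> card E \<Longrightarrow>
    \<exists>X :: 'k \<Rightarrow> 'v \<Rightarrow> real. dim (ext_row x X ` E) = dim (rig_row x ` E) + card I \<and>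
      (\<forall>i. i \<notin> I \<longrightarrow> X i = (\<lambda>v. 0))"
  using finite_class.finite[of I]
proof (induction I)
  case empty
  have "ext_row x (\<lambda>(i :: 'k) v. 0) ` E = (\<lambda>z. (z, 0)) ` (rig_row x ` E)"
    by (auto simp: ext_row_def image_image vec_eq_iff intro!: image_cong)
  also have "dim \<dots> = dim (rig_row x ` E)"
    by (rule dim_image_eq) (auto simp: inj_on_def intro!: linearI)
  finally show ?case by (intro exI[of _ "\<lambda>i v. 0"]) auto
next
  case (insert i I)
  then obtain X :: "'k \<Rightarrow> 'v \<Rightarrow> real"
    where X: "dim (ext_row x X ` E) = dim (rig_row x ` E) + card I"
      and X0: "\<And>i. i \<notin> I \<Longrightarrow> X i = (\<lambda>v. 0)"
    by auto
  have "dim (ext_row x X ` E) < card E" using insert X by simp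
  then have "\<not> indep_family E (ext_row x X)"
    using dim_indep_family[of E "ext_row x X"] by auto
  then obtain \<omega> e0 where \<omega>: "(\<Sum>e\<in>E. \<omega> e *\<^sub>R ext_row x X e) = 0" "e0 \<in> E" "\<omega> e0 \<noteq> 0"
    unfolding indep_family_def by blast
  obtain f where f: "(\<Sum>e\<in>E. \<omega> e * edge_sq f e) \<noteq> 0"
    using edge_sq_separates[where \<omega> = \<omega>, OF E \<omega>(2,3)] .
  define s where "s = (\<Sum>e\<in>E. \<omega> e * edge_sq f e)"
  define a :: "(real ^ ('v \<times> 'm)) \<times> (real ^ 'k)" where "a = (0, axis i 1)"
  let ?old = "ext_row x X ` E"
  let ?new = "ext_row x (X(i := f)) ` E"
  \<comment> \<open>the row dependency \<open>\<omega>\<close> is broken exactly in the new column, so the rank grows by one\<close>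
  have step: "ext_row x (X(i := f)) e = ext_row x X e + edge_sq f e *\<^sub>R a" for e
    using X0[OF insert(2)] by (auto simp: ext_row_def a_def vec_eq_iff axis_def)
  have "(\<Sum>e\<in>E. \<omega> e *\<^sub>R ext_row x (X(i := f)) e) = s *\<^sub>R a"
    unfolding step by (simp add: scaleR_add_right sum.distrib \<omega>(1) s_def scaleR_sum_left)
  moreover have "(\<Sum>e\<in>E. \<omega> e *\<^sub>R ext_row x (X(i := f)) e) \<in> span ?new"
    by (intro span_sum span_scale span_base) auto
  ultimately have "(1 / s) *\<^sub>R (s *\<^sub>R a) \<in> span ?new"
    by (metis span_scale)
  then have a_new: "a \<in> span ?new" using f by (simp add: s_def[symmetric])
  \<comment> \<open>As \<open>a\<close> itself lies in the new span, the old rows are recovered from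
    the new ones by subtraction.\<close>
  have "span ?new = span (insert a ?old)"
  proof (rule span_eq[THEN iffD2], intro conjI subsetI)
    fix y assume "y \<in> ?new"
    then obtain e where "e \<in> E" "y = ext_row x X e + edge_sq f e *\<^sub>R a" using step by auto
    then show "y \<in> span (insert a ?old)"
      by (auto intro!: span_add span_scale intro: span_base)
  next
    fix y assume y: "y \<in> insert a ?old"
    show "y \<in> span ?new"
    proof (cases "y = a")
      case False
      then obtain e where e: "e \<in> E" "y = ext_row x X e" using y by auto
      have "ext_row x (X(i := f)) e - edge_sq f e *\<^sub>R a \<in> span ?new"
        using e(1) a_new by (intro span_diff span_scale) (auto intro: span_base)
      then show ?thesis by (simp add: step e(2))
    qed (use a_new in simp)
  qed
  then have "dim ?new = dim (insert a ?old)" by (metis dim_span)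
  moreover have "a \<notin> span ?old"
  proof
    assume "a \<in> span ?old"
    moreover have "span ?old \<subseteq> {y. snd y $ i = 0}"
      by (rule span_minimal) (auto simp: ext_row_def X0[OF insert(2)] subspace_def)
    ultimately show False by (auto simp: a_def)
  qed
  ultimately have "dim ?new = dim (rig_row x ` E) + card (insert i I)"
    using X insert by (simp add: dim_insert)
  moreover have "(X(i := f)) j = (\<lambda>v. 0)" if "j \<notin> insert i I" for j
    using X0 that by simp
  ultimately show ?case by blast
qed

lemma dim_rig_row_ge_ext_row:
  fixes x :: "real ^ ('v::finite \<times> 'm::finite)" and X :: "'k::finite \<Rightarrow> 'v \<Rightarrow> real"
  shows "dim (ext_row x X ` E) \<le> dim (rig_row x ` E) + CARD('k)"
proof -
  have "ext_row x X ` E \<subseteq> span (rig_row x ` E) \<times> UNIV"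
    by (auto simp: ext_row_def intro: span_base)
  then have "dim (ext_row x X ` E) \<le> dim (span (rig_row x ` E) \<times> (UNIV :: (real ^ 'k) set))"
    by (rule dim_subset)
  also have "\<dots> = dim (rig_row x ` E) + CARD('k)"
    by (subst dim_Times) simp_all
  finally show ?thesis .
qed

section \<open>The kernel of \<open>J\<close> compared with that of the extended rigidity
  matrix\<close>

lemma J_row_Inl: "J_row v0 p (Inl e) = rig_row (config p) e"
  by (auto simp: J_row_def rig_row_def config_def vec_eq_iff)

lemma inner_J_row_Inr:
  assumes "v \<noteq> v0"
  shows "J_row v0 p (Inr (v, i)) \<bullet> y =
    y $ (v, Inr i) / p v0 $ Inr i - p v $ Inr i * y $ (v0, Inr i) / (p v0 $ Inr i)\<^sup>2"
proof -
  have "J_row v0 p (Inr (v, i)) = (1 / p v0 $ Inr i) *\<^sub>R axis (v, Inr i) 1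
      - (p v $ Inr i / (p v0 $ Inr i)\<^sup>2) *\<^sub>R axis (v0, Inr i) 1"
    using assms by (auto simp: J_row_def vec_eq_iff axis_def)
  then show ?thesis
    by (simp add: inner_diff_left inner_axis')
qed

text \<open>\<open>\<Psi>\<close> identifies the two kernels, and rank-nullity on both sides gives
  the equation.\<close>

lemma J_rank_eq_ext_row:
  fixes p :: "'v::finite \<Rightarrow> real ^ ('m::finite + 'k::finite)"
  assumes p0: "\<And>i :: 'k. p v0 $ Inr i \<noteq> 0"
  shows "J_rank v0 E p + CARD('m) * CARD('v) + CARD('k) =
    CARD('m + 'k) * CARD('v) +
    dim (ext_row (config (\<lambda>v. \<chi> j. p v $ Inl j)) (\<lambda>i v. p v $ Inr i) ` E)"
proof -
  define x where "x = config (\<lambda>v. \<chi> j :: 'm. p v $ Inl j)"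
  define X where "X = (\<lambda>(i :: 'k) v. p v $ Inr i)"
  let ?JR = "J_row v0 p ` J_row_indices v0 E"
  let ?ker = "{y. \<forall>s\<in>?JR. s \<bullet> y = 0}"
  let ?ext = "{y. \<forall>s\<in>ext_row x X ` E. s \<bullet> y = 0}"
  \<comment> \<open>A kernel vector is free in the first coordinates (\<open>z\<close>) and a
    multiple \<open>l $ i\<close> of the coordinate function of \<open>p\<close> in each of the last
    ones.\<close>
  define \<Psi> :: "(real ^ ('v \<times> 'm)) \<times> (real ^ 'k) \<Rightarrow> real ^ ('v \<times> ('m + 'k))"
    where "\<Psi> = (\<lambda>(z, l). \<chi> c. case snd c of Inl j \<Rightarrow> z $ (fst c, j) | Inr i \<Rightarrow> l $ i * p (fst c) $ Inr i)"
  have \<Psi>: "linear \<Psi>"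
    by (rule linearI) (auto simp: \<Psi>_def vec_eq_iff algebra_simps split: sum.split)
  have inj: "inj \<Psi>"
    unfolding linear_injective_0[OF \<Psi>]
  proof (intro allI impI)
    fix y assume y: "\<Psi> y = 0"
    obtain z l where zl: "y = (z, l)" by force
    have "z $ c = 0" for c
      using arg_cong[OF y, of "\<lambda>y. y $ (fst c, Inl (snd c))"] by (simp add: \<Psi>_def zl)
    moreover have "l $ i = 0" for i
      using arg_cong[OF y, of "\<lambda>y. y $ (v0, Inr i)"] p0[of i] by (simp add: \<Psi>_def zl)
    ultimately show "y = 0" by (simp add: zl vec_eq_iff zero_prod_def)
  qed
  have inner_sum_type: "a \<bullet> b = (\<Sum>j\<in>UNIV. a $ Inl j * b $ Inl j) + (\<Sum>i\<in>UNIV. a $ Inr i * b $ Inr i)"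
    for a b :: "real ^ ('m + 'k)"
    unfolding inner_vec_def UNIV_Plus_UNIV[symmetric] by (subst sum.Plus) simp_all
  have edge: "J_row v0 p (Inl e) \<bullet> \<Psi> (z, l) = ext_row x X e \<bullet> (z, l)" for e z l
  proof -
    have "(p u - p w) \<bullet> point (\<Psi> (z, l)) u
      = (point x u - point x w) \<bullet> point z u + (\<Sum>i\<in>UNIV. l $ i * ((X i u - X i w) * X i u))" for u w
      by (simp add: inner_sum_type \<Psi>_def point_def x_def config_def X_def inner_vec_def mult_ac)
    then have "J_row v0 p (Inl e) \<bullet> \<Psi> (z, l) = rig_row x e \<bullet> z
      + (\<Sum>u\<in>e. \<Sum>w\<in>e. \<Sum>i\<in>UNIV. l $ i * ((X i u - X i w) * X i u))"
      by (simp add: J_row_Inl inner_rig_row sum.distrib)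
    also have "(\<Sum>u\<in>e. \<Sum>w\<in>e. \<Sum>i\<in>UNIV. l $ i * ((X i u - X i w) * X i u))
      = (\<Sum>i\<in>UNIV. \<Sum>u\<in>e. \<Sum>w\<in>e. l $ i * ((X i u - X i w) * X i u))"
      by (rule trans[OF sum.cong[OF refl sum.swap] sum.swap])
    finally show ?thesis
      by (simp add: ext_row_def edge_sq_def inner_vec_def sum_distrib_left mult_ac)
  qed
  have "\<Psi> ` ?ext = ?ker"
  proof
    show "\<Psi> ` ?ext \<subseteq> ?ker"
    proof clarify
      fix z l and r :: "'v set + 'v \<times> 'k"
      assume zl: "\<forall>s\<in>ext_row x X ` E. s \<bullet> (z, l) = 0" and r: "r \<in> J_row_indices v0 E"
      show "J_row v0 p r \<bullet> \<Psi> (z, l) = 0"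
      proof (cases r)
        case (Inl e)
        then show ?thesis using zl r edge by (auto simp: J_row_indices_def)
      next
        case (Inr c)
        obtain v i where "c = (v, i)" by force
        then have "v \<noteq> v0" using r Inr by (auto simp: J_row_indices_def)
        then show ?thesis
          using p0[of i] by (simp add: Inr \<open>c = (v, i)\<close> inner_J_row_Inr \<Psi>_def field_simps power2_eq_square)
      qed
    qed
    show "?ker \<subseteq> \<Psi> ` ?ext"
    proof
      fix y assume y: "y \<in> ?ker"
      define z where "z = (\<chi> c. y $ (fst c, Inl (snd c)))"
      \<comment> \<open>The multiplier is read off at \<open>v0\<close>, where the coordinate is
        non-zero; the row indexed by \<open>(v, i)\<close> then fixes the entry at
        \<open>v\<close>.\<close>
      define l where "l = (\<chi> i. y $ (v0, Inr i) / p v0 $ Inr i)"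
      have "y $ (v, Inr i) = l $ i * p v $ Inr i" for v i
      proof (cases "v = v0")
        case False
        then have "Inr (v, i) \<in> J_row_indices v0 E"
          by (auto simp: J_row_indices_def)
        then have "J_row v0 p (Inr (v, i)) \<bullet> y = 0" using y by blast
        then show ?thesis
          using p0[of i] by (simp add: inner_J_row_Inr[OF False] l_def field_simps power2_eq_square)
      qed (use p0[of i] in \<open>simp add: l_def\<close>)
      then have yeq: "y = \<Psi> (z, l)"
        by (auto simp: \<Psi>_def z_def vec_eq_iff split: sum.split)
      have "ext_row x X e \<bullet> (z, l) = 0" if "e \<in> E" for e
      proof -
        have "Inl e \<in> (J_row_indices v0 E :: ('v set + 'v \<times> 'k) set)" using that by (auto simp: J_row_indices_def)
        then have "J_row v0 p (Inl e) \<bullet> y = 0" using y by blast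
        then show ?thesis by (simp add: yeq edge)
      qed
      then show "y \<in> \<Psi> ` ?ext" using yeq by blast
    qed
  qed
  moreover have "dim (\<Psi> ` ?ext) = dim ?ext"
    using \<Psi> inj by (intro dim_image_eq) (auto intro: inj_on_subset)
  ultimately have "dim ?ker = dim ?ext" by simp
  moreover have "J_rank v0 E p + dim ?ker = CARD('m + 'k) * CARD('v)"
    using dim_plus_dim_orthogonal[of ?JR] by (simp add: J_rank_def mult.commute)
  moreover have "dim (ext_row x X ` E) + dim ?ext = CARD('m) * CARD('v) + CARD('k)"
    using dim_plus_dim_orthogonal[of "ext_row x X ` E"] by (simp add: mult.commute)
  ultimately show ?thesis unfolding x_def X_def by linarith
qed

section \<open>Complete graphs\<close>

lemma complete_graph_dk_rigid:
  fixes E :: "'v::finite set set"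
  assumes "complete_graph E"
  shows "dk_rigid TYPE('m::finite) TYPE('k::finite) v0 E"
proof -
  let ?d = "min CARD('m + 'k) (CARD('v) - 1)"
  obtain B :: "(real ^ ('m + 'k)) set" where B: "B \<subseteq> Basis" "card B = ?d"
    using obtain_subset_with_card_n[of ?d "Basis :: (real ^ ('m + 'k)) set"] by auto
  have fin: "finite B" using B(1) finite_Basis finite_subset by blast
  have "card (insert 0 B) \<le> CARD('v)"
    using B(2) card_insert_le_m1[of "CARD('v)" B 0] by simp
  then obtain g where g: "inj_on g (insert 0 B)" "g ` insert 0 B \<subseteq> (UNIV :: 'v set)"
    using card_le_inj[of "insert 0 B" "UNIV :: 'v set"] fin by auto
  \<comment> \<open>The origin and the vectors of \<open>B\<close> are used as points; all surplus
    vertices go to the origin and do not change the affine hull.\<close>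
  define p where "p v = (if v \<in> g ` insert 0 B then inv_into (insert 0 B) g v else 0)" for v
  have "range p = insert 0 B"
  proof
    have "p v \<in> insert 0 B" for v
      unfolding p_def using inv_into_into[of v g "insert 0 B"] by (simp del: image_insert)
    then show "range p \<subseteq> insert 0 B" by blast
    show "insert 0 B \<subseteq> range p"
    proof
      fix y assume y: "y \<in> insert 0 B"
      then have "p (g y) = y" using g(1) by (auto simp: p_def)
      then show "y \<in> range p" by (metis rangeI)
    qed
  qed
  moreover have "aff_dim (insert 0 B) = int (dim (insert 0 B))"
    by (rule aff_dim_zero) (simp add: hull_inc)
  moreover have "dim (insert 0 B) = card B"
    using B(1) independent_mono[OF independent_Basis B(1)]
    by (simp add: dim_insert span_zero dim_eq_card_independent)
  ultimately have "inf_dk_rigid v0 E p"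
    using assms B(2) by (simp add: inf_dk_rigid_def)
  then show ?thesis unfolding dk_rigid_def by blast
qed

section \<open>Edge counts and the equivalence\<close>

text \<open>With n vertices, the bound is (n choose 2) + k for \<open>m = n\<close> and (n choose 2)
  - 1 + k for \<open>m = n + 1\<close>, both more than a non-complete graph has edges. For
  \<open>m = n + 2\<close> it drops to (n choose 2) - 3 + k and the argument breaks down.\<close>

lemma not_complete_edge_count_imp_card_less:
  fixes E :: "'v::finite set set"
  assumes E: "simple_graph E" "\<not> complete_graph E" and m: "m \<le> CARD('v) + 1" and k: "k \<ge> 1"
    and count: "int (card E) \<ge> int m * int CARD('v) - int ((m + 1) choose 2) + int k"
  shows "m < CARD('v)"
proof (rule ccontr)
  assume "\<not> m < CARD('v)"
  let ?n = "int CARD('v)"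
  \<comment> \<open>Doubled, the binomials become integer polynomials and the comparison needs no
    division.\<close>
  have two: "2 * int (a choose 2) = int a * (int a - 1)" for a
  proof -
    have "even (a * (a - 1))" by (cases a) auto
    then have "2 * (a choose 2) = a * (a - 1)" by (simp only: choose_two dvd_mult_div_cancel)
    then have "2 * int (a choose 2) = int (a * (a - 1))" by (metis of_nat_mult of_nat_numeral)
    then show ?thesis by (cases a) (auto simp: algebra_simps)
  qed
  have "E \<subset> {e. card e = 2}"
    using E by (auto simp: simple_graph_def complete_graph_def)
  then have "card E < card {e :: 'v set. card e = 2}"
    by (intro psubset_card_mono) auto
  also have "\<dots> = CARD('v) choose 2"
    using n_subsets[of "UNIV :: 'v set" 2] by simp
  finally have "2 * int (card E) + 2 \<le> ?n * (?n - 1)"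
    unfolding two[symmetric] by linarith
  moreover have "2 * int (card E) \<ge> 2 * (int m * ?n) - (int m + 1) * int m + 2"
  proof -
    have "2 * int ((m + 1) choose 2) = (int m + 1) * int m"
      unfolding two by simp
    then show ?thesis using count k by linarith
  qed
  moreover have "int m = ?n \<or> int m = ?n + 1"
    using m \<open>\<not> m < CARD('v)\<close> by linarith
  ultimately show False
    by (auto simp: algebra_simps)
qed

text \<open>The last hypothesis excludes small graphs for which the rank formula degenerates: with
  two vertices, no edge, \<open>d - k = 4\<close> and \<open>k = 2\<close>, the required rank is 12
  - 10 = 2 and is attained by the two rows for \<open>(v, i)\<close>, although the empty graph is
  not 4-rigid.\<close>

theorem theorem4p3:
  fixes d k :: nat and E :: "'v::finite set set" and v0 :: 'v
  assumes "d \<ge> 2" and "k \<in> {1..d - 1}"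
    and "CARD('m::finite) = d - k" and "CARD('k::finite) = k"
    and "simple_graph E"
    and "complete_graph E \<or> d - k \<le> CARD('v) + 1"
  shows "dk_rigid TYPE('m) TYPE('k) v0 E \<longleftrightarrow>
    complete_graph E \<or>
    ((\<exists>F\<subseteq>E. graph_rigid TYPE('m) F) \<and>
     int (card E) \<ge> int (d - k) * int CARD('v) - int ((d - k + 1) choose 2) + int k)"
proof (cases "complete_graph E")
  case True
  then show ?thesis using complete_graph_dk_rigid by blast
next
  case False
  let ?c = "(CARD('m) + 1) choose 2"
  let ?x = "\<lambda>p :: 'v \<Rightarrow> real ^ ('m + 'k). config (\<lambda>v. \<chi> j. p v $ Inl j)"
  let ?X = "\<lambda>(p :: 'v \<Rightarrow> real ^ ('m + 'k)) i v. p v $ Inr i"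
  let ?count = "int (card E) \<ge> int CARD('m) * int CARD('v) - int ?c + int CARD('k)"
  \<comment> \<open>Both directions need more vertices than dimensions, so that generic points
    affinely span; the edge bound provides this.\<close>
  have less: "CARD('m) < CARD('v)" if ?count
    using not_complete_edge_count_imp_card_less[OF assms(5) False _ _ that] assms False by auto
  have rank: "inf_dk_rigid v0 E p \<longleftrightarrow> (\<forall>i. p v0 $ Inr i \<noteq> 0) \<and>
      dim (ext_row (?x p) (?X p) ` E) + ?c = CARD('m) * CARD('v) + CARD('k)" for p
  proof (cases "\<forall>i. p v0 $ Inr i \<noteq> 0")
    case True
    then have "J_rank v0 E p + CARD('m) * CARD('v) + CARD('k) =
        CARD('m + 'k) * CARD('v) + dim (ext_row (?x p) (?X p) ` E)"
      by (intro J_rank_eq_ext_row) simp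
    from arg_cong[OF this, of int]
    have "int (J_rank v0 E p) = int CARD('m + 'k) * int CARD('v) - int ?c \<longleftrightarrow>
        int (dim (ext_row (?x p) (?X p) ` E) + ?c) = int (CARD('m) * CARD('v) + CARD('k))"
      unfolding of_nat_add of_nat_mult by linarith
    then show ?thesis
      using True False unfolding inf_dk_rigid_def of_nat_eq_iff by simp
  qed (use False in \<open>auto simp: inf_dk_rigid_def\<close>)
  have "dk_rigid TYPE('m) TYPE('k) v0 E \<longleftrightarrow> (\<exists>F\<subseteq>E. graph_rigid TYPE('m) F) \<and> ?count"
  proof
    assume "dk_rigid TYPE('m) TYPE('k) v0 E"
    then obtain p :: "'v \<Rightarrow> real ^ ('m + 'k)" where p: "inf_dk_rigid v0 E p"
      by (auto simp: dk_rigid_def)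
    let ?D = "dim (ext_row (?x p) (?X p) ` E)"
    have D: "?D + ?c = CARD('m) * CARD('v) + CARD('k)" using p rank by blast
    have "?D \<le> card (ext_row (?x p) (?X p) ` E)" by (rule dim_le_card') simp
    also have "\<dots> \<le> card E" by (rule card_image_le) simp
    finally have "CARD('m) * CARD('v) + CARD('k) \<le> card E + ?c" using D by linarith
    then have "int (CARD('m) * CARD('v) + CARD('k)) \<le> int (card E + ?c)"
      by (rule of_nat_mono)
    then have count: ?count unfolding of_nat_add of_nat_mult by linarith
    \<comment> \<open>Dropping the \<open>k\<close> extra columns leaves full rank in dimension
      \<open>m\<close>, so \<open>E\<close> itself serves as the rigid spanning subgraph.\<close>
    have "CARD('m) * CARD('v) \<le> dim (rig_row (?x p) ` E) + ?c"
      using D dim_rig_row_ge_ext_row[of "?x p" "?X p" E] by linarith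
    then have "graph_rigid TYPE('m) E"
      using graph_rigid_iff_rank[OF less[OF count] assms(5)] by blast
    then show "(\<exists>F\<subseteq>E. graph_rigid TYPE('m) F) \<and> ?count" using count by blast
  next
    assume "(\<exists>F\<subseteq>E. graph_rigid TYPE('m) F) \<and> ?count"
    then obtain F where F: "F \<subseteq> E" "graph_rigid TYPE('m) F" and count: ?count by blast
    have simple_F: "simple_graph F" using F(1) assms(5) by (auto simp: simple_graph_def)
    \<comment> \<open>A generic placement rigid for \<open>F\<close> already attains the maximal
      rank; the rank for \<open>E\<close>, lying between those for \<open>F\<close> and for all
      pairs, equals it.\<close>
    obtain p :: "'v \<Rightarrow> real ^ 'm" where p: "generic p" "rigid_framework F p"
      using F(2) by (auto simp: graph_rigid_def)
    have sp: "spans_space (config p)"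
      using p(1) less[OF count] generic_spans_space by (simp add: generic_iff_config)
    let ?r = "rig_row (config p)"
    have "dim (?r ` F) \<le> dim (?r ` E)"
      using F(1) by (intro dim_subset image_mono)
    moreover have "dim (?r ` E) \<le> dim (?r ` {e. card e = 2})"
      using assms(5) by (intro dim_subset image_mono) (auto simp: simple_graph_def)
    ultimately have dimE: "dim (?r ` E) + ?c = CARD('m) * CARD('v)"
      using rigid_framework_iff_rank[OF p(1) sp simple_F] p(2) dim_rig_rows_complete[OF sp]
      by linarith
    from arg_cong[OF this, of int]
    have "int (dim (?r ` E)) + int ?c = int CARD('m) * int CARD('v)"
      by (simp only: of_nat_add of_nat_mult)
    then have "dim (?r ` E) + card (UNIV :: 'k set) \<le> card E" using count by linarith
    then obtain X :: "'k \<Rightarrow> 'v \<Rightarrow> real"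
      where X: "dim (ext_row (config p) X ` E) = dim (?r ` E) + CARD('k)"
      using ext_row_dim_attained[OF assms(5)] by blast
    \<comment> \<open>Shifting by 1 exactly those columns that vanish at \<open>v0\<close> makes
      \<open>J\<close> defined there and preserves squared differences.\<close>
    define Y where "Y i v = X i v + (if X i v0 = 0 then 1 else 0)" for i v
    have "ext_row (config p) Y = ext_row (config p) X"
      unfolding Y_def by (simp add: fun_eq_iff ext_row_def edge_sq_shift)
    define P :: "'v \<Rightarrow> real ^ ('m + 'k)"
      where "P v = (\<chi> c. case c of Inl j \<Rightarrow> p v $ j | Inr i \<Rightarrow> Y i v)" for v
    have "?x P = config p" "?X P = Y" by (simp_all add: P_def config_def)
    then have "dim (ext_row (?x P) (?X P) ` E) + ?c = CARD('m) * CARD('v) + CARD('k)"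
      using X dimE \<open>ext_row (config p) Y = ext_row (config p) X\<close> by simp
    moreover have "\<forall>i. P v0 $ Inr i \<noteq> 0" by (simp add: P_def Y_def)
    ultimately have "inf_dk_rigid v0 E P" using rank by blast
    then show "dk_rigid TYPE('m) TYPE('k) v0 E" unfolding dk_rigid_def by blast
  qed
  then show ?thesis using False assms(3,4) by simp
qed

end
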